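(* In $\mathcal{A}_q(1,4)$ the following identities hold. (1)(i) If $m\in\mathbb{Z}$ is even and $n$ is a positive integer, then $X_mF_n(X_\delta)=q^{-\frac{n}{2}}X_{m-2n}+q^{\frac{n}{2}}X_{m+2n}$. (1)(ii) If $m$ is odd and $n$ is a positive integer, then $$X_mF_n(X_\delta)=q^{-n}X_{m-n}^{\langle m-n\rangle}+q^{n}X_{m+n}^{\langle m+n\rangle}+\sum_{k\geq1}\Big(\sum_{l=1}^{k}\big(q^{-\frac{4l-1}{2}}+q^{-\frac{4l-3}{2}}+q^{\frac{4l-3}{2}}+q^{\frac{4l-1}{2}}\big)\Big)F_{n-2k}(X_\delta).$$ (2) If $m$ is even and $n$ is a positive integer, then $$X_mX_{m+2n}=q^{\frac{n}{2}}X_{m+n}^{\langle m+n\rangle}+\sum_{k\geq1}\Big(\sum_{l=1}^{2k-1}q^{-\frac{n+1}{2}+l}\Big)F_{n-2k+1}(X_\delta).$$ (3) If $m$ is even and $n$ is a positive odd integer, then (sums over positive integers $k$) $$X_{m-n}X_m=\sum_{1<2k<n}\Big(\sum_{l=1}^{\min(4k,n-2k)}q^{-\frac12-k+l}\Big)X_{m-4k}+\begin{cases}q^{\frac n2}X_{m-\frac23 n}^3,& n\equiv0\pmod 3,\\ q^{\frac{n-1}{2}}X_{\lfloor m-\frac23 n\rfloor}X_{\lceil m-\frac23 n\rceil},&\text{otherwise},\end{cases}$$ and $$X_{m+n}X_m=\sum_{1<2k<n}\Big(\sum_{l=1}^{\min(4k,n-2k)}q^{\frac12+k-l}\Big)X_{m+4k}+\begin{cases}q^{-\frac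 n2}X_{m+\frac23 n}^3,& n\equiv0\pmod 3,\\ q^{-\frac{n+1}{2}}X_{\lfloor m+\frac23 n\rfloor}X_{\lceil m+\frac23 n\rceil},&\text{otherwise}.\end{cases}$$ (4) If $m$ is odd and $n$ is a positive integer, then $$X_mX_{m+2n}=q^{2n}X_{m+n}^{2\langle m+n\rangle}+\sum_{k=1}^{n-1}\Big(\sum_{l=1}^{4\min(k,n-k)}q^{-\frac12+l}\Big)X_{m+2n-2k}+\sum_{k\geq1}c_{n,k}F_{2n-2k}(X_\delta),$$ where $$c_{n,k}=\sum_{i=1}^{k}a_i\big(q^{-2(n-i)-1}+q^{4k-2(n+i)+1}\big)+\sum_{i=1}^{k-1}b_i\big(q^{-2(n-i)}+q^{4k-2(n+i)}\big)+b_kq^{-2(n-k)},$$ with $a_j=\frac{j(j-1)}{2}$ and $b_j=\frac{j(j-1)}{2}+\lceil\frac j2\rceil$ for positive integers $j$.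
   Context: Let $q^{1/2}$ be a formal variable and let $\mathcal{T}$ be the quantum torus over $\mathbb{Z}[q^{\pm\frac12}]$ generated by $X_1^{\pm1},X_2^{\pm1}$ subject to $X_1X_2=qX_2X_1$; let $\mathcal{F}$ be its skew field of fractions. Define elements $X_k\in\mathcal{F}$ for all $k\in\mathbb{Z}$ by the relations $X_{k-1}X_{k+1}=q^{\frac12}X_k+1$ if $k$ is odd and $X_{k-1}X_{k+1}=q^2X_k^4+1$ if $k$ is even. The quantum cluster algebra $\mathcal{A}_q(1,4)$ is the $\mathbb{Z}[q^{\pm\frac12}]$-subalgebra of $\mathcal{F}$ generated by all $X_k$, $k\in\mathbb{Z}$ (all $X_k$ lie in $\mathcal{T}$). For $(a,b)\in\mathbb{Z}^2$ put $X^{(a,b)}=q^{-\frac12 ab}X_1^aX_2^b$. Let $X_\delta=X^{(-1,-2)}+X^{(-1,2)}+X^{(1,-2)}+(q^{-\frac12}+q^{\frac12})X^{(0,-2)}$. The Chebyshev polynomials $F_n$ are defined by $F_0(x)=1$, $F_1(x)=x$, $F_2(x)=x^2-2$, $F_{n+1}(x)=F_n(x)x-F_{n-1}(x)$ for $n\ge2$, and $F_n(x)=0$ for $n<0$. For $n\in\mathbb{Z}$, $\langle n\rangle=1$ if $n$ is odd and $\langle n\rangle=2$ if $n$ is even. $\lfloor\cdot\rfloor,\lceil\cdot\rceil$ are floor and ceiling. *)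

theory Defs
  imports Complex_Main "HOL-Library.Poly_Mapping"
begin

text \<open>Quantum torus T over Z[v,v^-1], v = q^(1/2).  An element is a finitely supported
  integer-valued function on triples (j,a,b); the triple (j,a,b) stands for v^j X^(a,b),
  where X^(a,b) = q^(-ab/2) X1^a X2^b is the normalized monomial.  These form a Z-basis
  of T, and X^(a,b) X^(c,d) = q^((ad-bc)/2) X^(a+c,b+d).\<close>

type_synonym qt = "(int \<times> int \<times> int) \<Rightarrow>\<^sub>0 int"

fun twist :: "int \<times> int \<times> int \<Rightarrow> int \<times> int \<times> int \<Rightarrow> int \<times> int \<times> int" where
  "twist (j, a, b) (k, c, d) = (j + k + a * d - b * c, a + c, b + d)"

definition qmult :: "qt \<Rightarrow> qt \<Rightarrow> qt" (infixl "\<odot>" 70) where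
  "f \<odot> g = (\<Sum>x\<in>Poly_Mapping.keys f. \<Sum>y\<in>Poly_Mapping.keys g.
              Poly_Mapping.single (twist x y) (Poly_Mapping.lookup f x * Poly_Mapping.lookup g y))"

text \<open>qh j is the central scalar q^(j/2) = v^j.\<close>
definition qh :: "int \<Rightarrow> qt" where
  "qh j = Poly_Mapping.single (j, 0, 0) 1"

definition qint :: "int \<Rightarrow> qt" where
  "qint c = Poly_Mapping.single (0, 0, 0) c"

definition qone :: qt where
  "qone = qh 0"

text \<open>tX a b is the normalized monomial X^(a,b) = q^(-ab/2) X1^a X2^b;
  X1 = tX 1 0, X2 = tX 0 1.\<close>
definition tX :: "int \<Rightarrow> int \<Rightarrow> qt" where
  "tX a b = Poly_Mapping.single (0, a, b) 1"

primrec qpow :: "qt \<Rightarrow> nat \<Rightarrow> qt" where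
  "qpow f 0 = qone"
| "qpow f (Suc n) = qpow f n \<odot> f"

fun cheb :: "qt \<Rightarrow> nat \<Rightarrow> qt" where
  "cheb x 0 = qone"
| "cheb x (Suc 0) = x"
| "cheb x (Suc (Suc 0)) = x \<odot> x - qint 2"
| "cheb x (Suc (Suc (Suc n))) = cheb x (Suc (Suc n)) \<odot> x - cheb x (Suc n)"

definition F :: "int \<Rightarrow> qt \<Rightarrow> qt" where
  "F n x = (if n < 0 then 0 else cheb x (nat n))"

definition Xdelta :: qt where
  "Xdelta = tX (-1) (-2) + tX (-1) 2 + tX 1 (-2) + (qh (-1) + qh 1) \<odot> tX 0 (-2)"

definition ang :: "int \<Rightarrow> nat" where
  "ang n = (if odd n then 1 else 2)"

definition acoef :: "int \<Rightarrow> int" where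
  "acoef j = j * (j - 1) div 2"

definition bcoef :: "int \<Rightarrow> int" where
  "bcoef j = j * (j - 1) div 2 + \<lceil>real_of_int j / 2\<rceil>"

text \<open>c_{n,k}; q^e is written qh (2*e).\<close>
definition cnk :: "int \<Rightarrow> int \<Rightarrow> qt" where
  "cnk n k =
     (\<Sum>i\<in>{1..k}. qint (acoef i) \<odot>
        (qh (2 * (- 2 * (n - i) - 1)) + qh (2 * (4 * k - 2 * (n + i) + 1))))
   + (\<Sum>i\<in>{1..k - 1}. qint (bcoef i) \<odot>
        (qh (2 * (- 2 * (n - i))) + qh (2 * (4 * k - 2 * (n + i)))))
   + qint (bcoef k) \<odot> qh (2 * (- 2 * (n - k)))"

end

theory Submission
  imports Defs "HOL-Library.Product_Lexorder"
begin

text \<open>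
  Write \<open>w j = q^(j/2)\<close> and \<open>D\<close> for the element \<open>X_\<delta>\<close>. The quantum torus is a domain (compare
  leading terms), so the exchange relations determine all \<open>X k\<close>, and induction in both directions from
  the initial cluster gives the quasi-commutation \<open>X k X (k+1) = q X (k+1) X k\<close>, the reversed exchange
  relations, and the action of \<open>D\<close> from the right:
  \<open>X k D = q^(-1/2) X (k-2) + q^(1/2) X (k+2)\<close> and
  \<open>X k ^ 2 D = q^-1 X (k-1) + q X (k+1) + q^(1/2) + q^(-1/2)\<close> for even \<open>k\<close>, and
  \<open>X k D = q^-1 X (k-1) ^ 2 + q X (k+1) ^ 2\<close> for odd \<open>k\<close>.

  These relations are invariant under \<open>k \<mapsto> -k\<close>, \<open>q \<mapsto> q^-1\<close>, and they suffice: multiplying by \<open>D\<close>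
  (in part (4) by \<open>F 2 (D)\<close>) turns each side of each identity into a solution of the same three-term
  recursion in \<open>n\<close>. Only few coefficients have to be compared, because in the sums almost all terms of
  the recursion cancel. In part (4) one has \<open>c_{n,k} = q^(-2n) \<gamma>_k\<close>, so that only the coefficient of
  \<open>F 0\<close> is at stake; it amounts to an identity for \<open>\<gamma>_(n+1) - \<gamma>_(n-1)\<close>, which follows from a
  recursion of step 2 in \<open>n\<close>.
\<close>

section \<open>Linear combinations over the center of a ring\<close>

text \<open>All coefficients in the identities are polynomials in powers of \<open>q^(1/2)\<close>,
  hence central. Making the center a type of class \<open>comm_ring_1\<close> lets the simplifier
  normalise coefficients commutatively while the cluster variables stay in a noncommutative
  ring.\<close>

typedef (overloaded) 'a center = "{c :: 'a::ring_1. \<forall>x. c * x = x * c}"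
  morphisms of_center Abs_center
  by (rule exI[of _ 0]) simp

setup_lifting type_definition_center

instantiation center :: (ring_1) comm_ring_1
begin

lift_definition zero_center :: "'a center" is 0 by simp
lift_definition one_center :: "'a center" is 1 by simp
lift_definition plus_center :: "'a center \<Rightarrow> 'a center \<Rightarrow> 'a center" is "(+)"
  by (simp add: distrib_left distrib_right)
lift_definition minus_center :: "'a center \<Rightarrow> 'a center \<Rightarrow> 'a center" is "(-)"
  by (simp add: left_diff_distrib right_diff_distrib)
lift_definition uminus_center :: "'a center \<Rightarrow> 'a center" is uminus
  by simp
lift_definition times_center :: "'a center \<Rightarrow> 'a center \<Rightarrow> 'a center" is "(*)"
  by (metis mult.assoc)

instance
proof
  fix a b c :: "'a center"
  show "a * b = b * a"
    by transfer blast
qed (simp_all flip: of_center_inject add: algebra_simps zero_center.rep_eq one_center.rep_eq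
    plus_center.rep_eq minus_center.rep_eq uminus_center.rep_eq times_center.rep_eq)

end

lemmas of_center_simps = zero_center.rep_eq one_center.rep_eq
  plus_center.rep_eq minus_center.rep_eq uminus_center.rep_eq times_center.rep_eq

lemma of_center_commute: "x * of_center c = of_center c * x"
  by transfer metis

lemma of_center_sum: "of_center (sum f A) = (\<Sum>x\<in>A. of_center (f x))"
  by (induction A rule: infinite_finite_induct) (simp_all add: of_center_simps)

lemma of_center_of_int: "of_center (of_int c) = of_int c"
proof -
  have nat: "of_center (of_nat n) = of_nat n" for n
    by (induction n) (simp_all add: of_center_simps)
  show ?thesis
    by (cases c) (simp_all add: nat of_center_simps)
qed

text \<open>A separate operation rather than a plain product: coefficients then gather at the front
  of each term and are multiplied inside the commutative type \<open>'a center\<close>.\<close>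

definition cscale :: "'a::ring_1 center \<Rightarrow> 'a \<Rightarrow> 'a" (infixr "*\<^sub>c" 75)
  where "c *\<^sub>c x = of_center c * x"

lemma cscale_simps [simp]:
  "0 *\<^sub>c x = 0" "1 *\<^sub>c x = x" "c *\<^sub>c 0 = 0" "(- c) *\<^sub>c x = - (c *\<^sub>c x)" "c *\<^sub>c (- x) = - (c *\<^sub>c x)"
  "c *\<^sub>c (d *\<^sub>c x) = (c * d) *\<^sub>c x"
  by (simp_all add: cscale_def of_center_simps mult.assoc)

lemma cscale_distrib:
  "(c + d) *\<^sub>c x = c *\<^sub>c x + d *\<^sub>c x" "c *\<^sub>c (x + y) = c *\<^sub>c x + c *\<^sub>c y"
  "(c - d) *\<^sub>c x = c *\<^sub>c x - d *\<^sub>c x" "c *\<^sub>c (x - y) = c *\<^sub>c x - c *\<^sub>c y"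
  by (simp_all add: cscale_def of_center_simps algebra_simps)

lemma cscale_mult: "(c *\<^sub>c x) * y = c *\<^sub>c (x * y)" "x * (c *\<^sub>c y) = c *\<^sub>c (x * y)"
  by (simp_all add: cscale_def mult.assoc) (metis mult.assoc of_center_commute)

lemma cscale_sum_left: "sum f A *\<^sub>c x = (\<Sum>k\<in>A. f k *\<^sub>c x)"
  by (induction A rule: infinite_finite_induct) (simp_all add: cscale_distrib)

lemma cscale_sum_right: "c *\<^sub>c sum f A = (\<Sum>k\<in>A. c *\<^sub>c f k)"
  by (induction A rule: infinite_finite_induct) (simp_all add: cscale_distrib)

lemmas cscale_expand = cscale_distrib cscale_mult distrib_left distrib_right
  left_diff_distrib right_diff_distrib cscale_sum_right sum_distrib_right sum_distrib_left

section \<open>Chebyshev polynomials\<close>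

fun chebyshev :: "'a::ring_1 \<Rightarrow> nat \<Rightarrow> 'a" where
  "chebyshev x 0 = 1"
| "chebyshev x (Suc 0) = x"
| "chebyshev x (Suc (Suc 0)) = x * x - 2"
| "chebyshev x (Suc (Suc (Suc n))) = chebyshev x (Suc (Suc n)) * x - chebyshev x (Suc n)"

definition Fcheb :: "'a::ring_1 \<Rightarrow> int \<Rightarrow> 'a" where
  "Fcheb x n = (if n < 0 then 0 else chebyshev x (nat n))"

lemma Fcheb_simps [simp]: "Fcheb x 0 = 1" "Fcheb x 1 = x" "n < 0 \<Longrightarrow> Fcheb x n = 0"
  by (simp_all add: Fcheb_def)

lemma Fcheb_2: "Fcheb x 2 = x * x - 2"
  by (simp add: Fcheb_def numeral_2_eq_2)

text \<open>The corrections at \<open>n = 1\<close> and \<open>n = -1\<close> come from \<open>F 0 = 1\<close> (instead of 2) and from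
  truncating at negative indices.\<close>

lemma Fcheb_mult:
  "Fcheb x n * x = Fcheb x (n + 1) + Fcheb x (n - 1) + of_bool (n = 1) - of_bool (n = -1)"
proof -
  consider "n < -1" | "n = -1" | "n = 0" | "n = 1" | "2 \<le> n" by linarith
  then show ?thesis
  proof cases
    case 4
    then show ?thesis using Fcheb_2[of x] by simp
  next
    case 5
    then have "n = int (Suc (Suc (nat (n - 2))))" by simp
    then obtain k where "n = int (Suc (Suc k))" ..
    then show ?thesis by (simp add: Fcheb_def nat_add_distrib nat_diff_distrib numeral_3_eq_3)
  qed auto
qed

text \<open>Since \<open>F 2\<close> is \<open>x * x - 2\<close>, this is \<open>Fcheb_mult\<close>
  applied twice. Even \<open>n\<close> avoids the corrections in the first application; in the
  second, those at \<open>n = 0\<close> coming from the two neighbours cancel.\<close>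

lemma Fcheb_mult_F2:
  assumes "even n"
  shows "Fcheb x n * Fcheb x 2 =
    Fcheb x (n + 2) + Fcheb x (n - 2) + of_bool (n = 2) - of_bool (n = -2)"
proof -
  have ne: "n \<noteq> 1" "n \<noteq> -1" using assms by auto
  have "Fcheb x n * Fcheb x 2 = Fcheb x n * x * x - 2 * Fcheb x n"
    by (simp add: Fcheb_2 right_diff_distrib mult.assoc mult_2 mult_2_right)
  also have "Fcheb x n * x * x = Fcheb x (n + 1) * x + Fcheb x (n - 1) * x"
    using ne by (simp add: Fcheb_mult[of x n] distrib_right)
  also have "\<dots> = Fcheb x (n + 2) + Fcheb x (n - 2) + 2 * Fcheb x n + of_bool (n = 2) - of_bool (n = -2)"
    by (simp add: Fcheb_mult algebra_simps mult_2)
  finally show ?thesis by (simp add: algebra_simps)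
qed

section \<open>Finite sums of Chebyshev polynomials\<close>

lemma sum_atLeastAtMost_int_Suc:
  fixes f :: "int \<Rightarrow> 'b::comm_monoid_add"
  assumes "a \<le> k"
  shows "sum f {a..k} = sum f {a..k - 1} + f k"
proof -
  have "{a..k} = insert k {a..k - 1}" using assms by auto
  then show ?thesis by (simp add: add.commute)
qed

text \<open>The selected index may lie outside \<open>A\<close> as long as \<open>f\<close> vanishes
  there. This covers the boundary index 0 in the sums below, where the coefficient function is
  0.\<close>

lemma sum_single_index:
  fixes f :: "'b \<Rightarrow> 'a::comm_monoid_add"
  assumes "finite A" "\<And>k. k \<in> A \<Longrightarrow> P k \<longleftrightarrow> k = a \<and> Q" "a \<notin> A \<Longrightarrow> Q \<Longrightarrow> f a = 0"
  shows "(\<Sum>k\<in>A. if P k then f k else 0) = (if Q then f a else 0)"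
proof -
  have "(\<Sum>k\<in>A. if P k then f k else 0) = (\<Sum>k\<in>A. if k = a then (if Q then f k else 0) else 0)"
    by (rule sum.cong) (use assms(2) in auto)
  also have "\<dots> = (if Q then f a else 0)"
    using assms(1,3) by (simp add: sum.delta)
  finally show ?thesis .
qed

text \<open>By \<open>Fcheb_mult\<close> only the summands with Chebyshev index 1 or -1 deviate from
  the three-term recursion; for odd \<open>a\<close> these are the two neighbouring values of
  \<open>k\<close> around \<open>a / 2\<close>. One common range is used for all sums so that they
  can be compared termwise.\<close>

lemma cheb_sum_mult:
  fixes f :: "int \<Rightarrow> 'a::ring_1 center"
  assumes "f 0 = 0" "0 \<le> a" "a \<le> N"
  shows "(\<Sum>k\<in>{1..N}. f k *\<^sub>c Fcheb x (a - 2 * k)) * x =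
     (\<Sum>k\<in>{1..N}. f k *\<^sub>c Fcheb x (a + 1 - 2 * k)) + (\<Sum>k\<in>{1..N}. f k *\<^sub>c Fcheb x (a - 1 - 2 * k))
     + (if odd a then (f ((a - 1) div 2) - f ((a + 1) div 2)) *\<^sub>c 1 else 0)"
proof -
  have 1: "(\<Sum>k\<in>{1..N}. if a - 2 * k = 1 then f k else 0) = (if odd a then f ((a - 1) div 2) else 0)"
  proof (rule sum_single_index)
    assume "(a - 1) div 2 \<notin> {1..N}" "odd a"
    then have "(a - 1) div 2 = 0" using assms(2,3) by (auto simp: not_le) presburger+
    then show "f ((a - 1) div 2) = 0" using assms by simp
  qed (simp, presburger)
  have 2: "(\<Sum>k\<in>{1..N}. if a - 2 * k = -1 then f k else 0) = (if odd a then f ((a + 1) div 2) else 0)"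
  proof (rule sum_single_index)
    assume "(a + 1) div 2 \<notin> {1..N}" "odd a"
    then have False using assms(2,3) by (auto simp: not_le) presburger+
    then show "f ((a + 1) div 2) = 0" ..
  qed (simp, presburger)
  have e: "f k *\<^sub>c of_bool P = (if P then f k else 0) *\<^sub>c 1" for k P
    by simp
  have "(\<Sum>k\<in>{1..N}. f k *\<^sub>c Fcheb x (a - 2 * k)) * x =
     (\<Sum>k\<in>{1..N}. f k *\<^sub>c Fcheb x (a + 1 - 2 * k)) + (\<Sum>k\<in>{1..N}. f k *\<^sub>c Fcheb x (a - 1 - 2 * k))
     + (\<Sum>k\<in>{1..N}. if a - 2 * k = 1 then f k else 0) *\<^sub>c 1
     - (\<Sum>k\<in>{1..N}. if a - 2 * k = -1 then f k else 0) *\<^sub>c 1"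
    unfolding cscale_sum_left e[symmetric]
    by (simp add: cscale_expand Fcheb_mult sum.distrib sum_subtractf algebra_simps)
  then show ?thesis unfolding 1 2 by (simp add: cscale_distrib)
qed

lemma cheb_sum_mult_F2:
  fixes f :: "int \<Rightarrow> 'a::ring_1 center"
  assumes "f 0 = 0" "1 \<le> a" "a < N"
  shows "(\<Sum>k\<in>{1..N}. f k *\<^sub>c Fcheb x (2 * a - 2 * k)) * Fcheb x 2 =
     (\<Sum>k\<in>{1..N}. f k *\<^sub>c Fcheb x (2 * a + 2 - 2 * k)) + (\<Sum>k\<in>{1..N}. f k *\<^sub>c Fcheb x (2 * a - 2 - 2 * k))
     + (f (a - 1) - f (a + 1)) *\<^sub>c 1"
proof -
  have 1: "(\<Sum>k\<in>{1..N}. if 2 * a - 2 * k = 2 then f k else 0) = (if True then f (a - 1) else 0)"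
    by (rule sum_single_index) (use assms in auto)
  have 2: "(\<Sum>k\<in>{1..N}. if 2 * a - 2 * k = -2 then f k else 0) = (if True then f (a + 1) else 0)"
    by (rule sum_single_index) (use assms in auto)
  have e: "f k *\<^sub>c of_bool P = (if P then f k else 0) *\<^sub>c 1" for k P
    by simp
  have "(\<Sum>k\<in>{1..N}. f k *\<^sub>c Fcheb x (2 * a - 2 * k)) * Fcheb x 2 =
     (\<Sum>k\<in>{1..N}. f k *\<^sub>c Fcheb x (2 * a + 2 - 2 * k)) + (\<Sum>k\<in>{1..N}. f k *\<^sub>c Fcheb x (2 * a - 2 - 2 * k))
     + (\<Sum>k\<in>{1..N}. if 2 * a - 2 * k = 2 then f k else 0) *\<^sub>c 1
     - (\<Sum>k\<in>{1..N}. if 2 * a - 2 * k = -2 then f k else 0) *\<^sub>c 1"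
    unfolding cscale_sum_left e[symmetric]
    by (simp add: cscale_expand Fcheb_mult_F2 sum.distrib sum_subtractf algebra_simps)
  then show ?thesis unfolding 1 2 by (simp add: cscale_distrib)
qed

text \<open>Beyond \<open>M\<close> the Chebyshev index is negative, so the additional terms
  vanish.\<close>

lemma cheb_sum_extend:
  fixes f :: "int \<Rightarrow> 'a::ring_1 center"
  assumes "a \<le> 2 * M + 1" "M \<le> N"
  shows "(\<Sum>k\<in>{1..N}. f k *\<^sub>c Fcheb x (a - 2 * k)) = (\<Sum>k\<in>{1..M}. f k *\<^sub>c Fcheb x (a - 2 * k))"
  by (rule sum.mono_neutral_right) (use assms in auto)

section \<open>Two-step induction and the integers a_j, b_j\<close>

lemma int_two_step_induct [consumes 1, case_names zero one step]:
  fixes n :: int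
  assumes "0 \<le> n" "P 0" "P 1" "\<And>n. 1 \<le> n \<Longrightarrow> P (n - 1) \<Longrightarrow> P n \<Longrightarrow> P (n + 1)"
  shows "P n"
proof -
  have "P n \<and> P (n + 1)"
    using assms(1)
  proof (induction n rule: int_ge_induct)
    case (step i)
    then show ?case using assms(4)[of "i + 1"] by simp
  qed (use assms in simp)
  then show ?thesis ..
qed

lemma acoef_step: "acoef (j + 1) = acoef j + j"
proof -
  have "(j + 1) * (j + 1 - 1) = j * (j - 1) + j * 2" by (simp add: algebra_simps)
  then show ?thesis unfolding acoef_def by simp
qed

lemma bcoef_eq: "bcoef j = acoef j + (j + 1) div 2"
proof -
  have "\<lceil>real_of_int j / 2\<rceil> = (j + 1) div 2"
    by (simp add: ceiling_eq_iff) linarith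
  then show ?thesis by (simp add: bcoef_def acoef_def)
qed

text \<open>The ceiling of \<open>j / 2\<close> grows uniformly only over two steps; this forces the
  later recursions for the scalar coefficients to have step 2 as well.\<close>

lemma bcoef_step2: "bcoef (j + 2) = bcoef j + 2 * j + 2"
proof -
  have "acoef (j + 2) = acoef j + 2 * j + 1"
    using acoef_step[of j] acoef_step[of "j + 1"] by (simp add: add.commute)
  moreover have "(j + 2 + 1) div 2 = (j + 1) div 2 + 1" by presburger
  ultimately show ?thesis unfolding bcoef_eq by simp
qed

lemma ab_coef_values [simp]: "acoef 0 = 0" "acoef 1 = 0" "bcoef 0 = 0" "bcoef 1 = 1"
  by (simp_all add: acoef_def bcoef_eq)

section \<open>Consequences of the exchange relations\<close>

text \<open>Each exchange relation is included in both orders of its factors. This makes the axioms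
  symmetric under reflection of the index combined with inversion of \<open>q\<close>.\<close>

locale cluster_exchange =
  fixes w :: "int \<Rightarrow> 'a::ring_1 center" and X :: "int \<Rightarrow> 'a"
  assumes w_mult: "w i * w j = w (i + j)"
    and w_0 [simp]: "w 0 = 1"
    and quasi_comm: "X k * X (k + 1) = w 2 *\<^sub>c (X (k + 1) * X k)"
    and exchange_odd: "odd k \<Longrightarrow> X (k - 1) * X (k + 1) = w 1 *\<^sub>c X k + 1"
    and exchange_odd': "odd k \<Longrightarrow> X (k + 1) * X (k - 1) = w (-1) *\<^sub>c X k + 1"
    and exchange_even: "even k \<Longrightarrow> X (k - 1) * X (k + 1) = w 4 *\<^sub>c X k ^ 4 + 1"
    and exchange_even': "even k \<Longrightarrow> X (k + 1) * X (k - 1) = w (-4) *\<^sub>c X k ^ 4 + 1"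
begin

lemma w_mult_left: "w i * (w j * c) = w (i + j) * c"
  by (simp add: w_mult flip: mult.assoc)

lemmas w_simps = w_mult w_mult_left

lemma quasi_comm': "X (k + 1) * X k = w (-2) *\<^sub>c (X k * X (k + 1))"
  by (simp add: quasi_comm w_simps)

text \<open>Reflection interchanges the two orders of the factors, and inverting \<open>q\<close>
  restores the coefficients. Statements about smaller indices thus follow from those about larger
  ones.\<close>

lemma reflect_exchange: "cluster_exchange (\<lambda>j. w (- j)) (\<lambda>k. X (- k))"
proof
  fix i j k :: int
  have e: "- (k + 1) = - k - 1" "- (k - 1) = - k + 1" "- (k + 2) = - k - 2" "- (k - 2) = - k + 2"
    by simp_all
  show "w (- i) * w (- j) = w (- (i + j))" by (simp add: w_mult)
  show "w (- 0) = 1" by simp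
  show "X (- k) * X (- (k + 1)) = w (- 2) *\<^sub>c (X (- (k + 1)) * X (- k))"
    unfolding e using quasi_comm'[of "- k - 1"] by simp
  show "X (- (k - 1)) * X (- (k + 1)) = w (- 1) *\<^sub>c X (- k) + 1" if "odd k"
    using exchange_odd'[of "- k"] that unfolding e by (simp add: add.commute)
  show "X (- (k + 1)) * X (- (k - 1)) = w (- (- 1)) *\<^sub>c X (- k) + 1" if "odd k"
    using exchange_odd[of "- k"] that unfolding e by (simp add: add.commute)
  show "X (- (k - 1)) * X (- (k + 1)) = w (- 4) *\<^sub>c X (- k) ^ 4 + 1" if "even k"
    using exchange_even'[of "- k"] that unfolding e by (simp add: add.commute)
  show "X (- (k + 1)) * X (- (k - 1)) = w (- (- 4)) *\<^sub>c X (- k) ^ 4 + 1" if "even k"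
    using exchange_even[of "- k"] that unfolding e by (simp add: add.commute)
qed

text \<open>The exchange relation is applied to the inner product \<open>X k * X (k + 2)\<close>.
  Moving \<open>X k\<close> past the resulting \<open>X (k + 1)\<close> costs \<open>w 2\<close> and
  brings \<open>X k\<close> and \<open>X (k + 2)\<close> together a second time.\<close>

lemma even_square_square_up:
  assumes "even k"
  shows "X k * X k * (X (k + 2) * X (k + 2)) = w 4 *\<^sub>c (X (k + 1) * X (k + 1)) + (w 1 + w 3) *\<^sub>c X (k + 1) + 1"
proof -
  have ex: "X k * X (k + 2) = w 1 *\<^sub>c X (k + 1) + 1"
    using exchange_odd[of "k + 1"] assms by (simp add: add.commute)
  have "X k * X k * (X (k + 2) * X (k + 2)) = X k * (X k * X (k + 2)) * X (k + 2)"
    by (simp add: mult.assoc)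
  also have "\<dots> = w 1 *\<^sub>c (X k * X (k + 1) * X (k + 2)) + X k * X (k + 2)"
    unfolding ex by (simp add: cscale_expand ex)
  also have "X k * X (k + 1) * X (k + 2) = w 2 *\<^sub>c (X (k + 1) * (X k * X (k + 2)))"
    by (simp add: quasi_comm cscale_expand mult.assoc)
  finally show ?thesis unfolding ex by (simp add: cscale_expand w_simps)
qed

lemma even_square_square_down:
  assumes "even k"
  shows "X k * X k * (X (k - 2) * X (k - 2)) =
    w (-4) *\<^sub>c (X (k - 1) * X (k - 1)) + (w (-1) + w (-3)) *\<^sub>c X (k - 1) + 1"
proof -
  interpret R: cluster_exchange "\<lambda>j. w (- j)" "\<lambda>k. X (- k)"
    by (rule reflect_exchange)
  have "- (- k + 2) = k - 2" "- (- k + 1) = k - 1" by simp_all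
  then show ?thesis
    using R.even_square_square_up[of "- k"] assms by simp
qed

text \<open>Multiply the claim by \<open>X k * X k\<close> from the left. Moving this square past
  \<open>X (k + 1)\<close> costs \<open>w 4\<close> and lets it meet \<open>D\<close>, so
  \<open>E\<close> applies; the result is rewritten by the reversed exchange relation at
  \<open>k\<close> and \<open>even_square_square_up\<close>. Cancellation is a hypothesis here and
  is supplied once the ring is known to be a domain.\<close>

lemma even_to_odd_D:
  assumes cancel: "\<And>k y z. X k * y = X k * z \<Longrightarrow> y = z"
    and "even k"
    and E: "X k * X k * D = w (-2) *\<^sub>c X (k - 1) + w 2 *\<^sub>c X (k + 1) + (w 1 + w (-1)) *\<^sub>c 1"
  shows "X (k + 1) * D = w (-2) *\<^sub>c (X k * X k) + w 2 *\<^sub>c (X (k + 2) * X (k + 2))"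
proof -
  have p4: "X k ^ 4 = X k * X k * (X k * X k)"
    by (simp add: numeral_eq_Suc mult.assoc)
  have "X k * X k * X (k + 1) = w 4 *\<^sub>c (X (k + 1) * (X k * X k))"
    unfolding mult.assoc quasi_comm[of k] cscale_mult
    by (simp add: quasi_comm[of k] cscale_mult w_simps flip: mult.assoc)
  then have "X k * X k * (X (k + 1) * D) = w 4 *\<^sub>c (X (k + 1) * (X k * X k * D))"
    by (simp add: cscale_mult flip: mult.assoc)
  also have "\<dots> = w 2 *\<^sub>c (X (k + 1) * X (k - 1)) + w 6 *\<^sub>c (X (k + 1) * X (k + 1)) + (w 5 + w 3) *\<^sub>c X (k + 1)"
    unfolding E by (simp add: cscale_expand w_simps)
  also have "\<dots> = w (-2) *\<^sub>c (X k * X k * (X k * X k))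
      + w 2 *\<^sub>c (X k * X k * (X (k + 2) * X (k + 2)))"
    unfolding exchange_even'[OF \<open>even k\<close>] even_square_square_up[OF \<open>even k\<close>] p4
    by (simp add: cscale_distrib w_simps algebra_simps)
  also have "\<dots> = X k * X k * (w (-2) *\<^sub>c (X k * X k) + w 2 *\<^sub>c (X (k + 2) * X (k + 2)))"
    by (simp add: cscale_mult distrib_left)
  finally show ?thesis using cancel[of k] by (simp add: mult.assoc)
qed

text \<open>Here \<open>X k\<close> is multiplied from the left and moved past the square of
  \<open>X (k + 1)\<close> to reach \<open>D\<close>. Of the two products that arise, one is given
  by \<open>even_square_square_down\<close>, and the other is the fourth power in the exchange
  relation at \<open>k + 1\<close>.\<close>

lemma odd_to_even_D:
  assumes cancel: "\<And>k y z. X k * y = X k * z \<Longrightarrow> y = z"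
    and "odd k"
    and O: "X k * D = w (-2) *\<^sub>c (X (k - 1) * X (k - 1)) + w 2 *\<^sub>c (X (k + 1) * X (k + 1))"
  shows "X (k + 1) * X (k + 1) * D = w (-2) *\<^sub>c X k + w 2 *\<^sub>c X (k + 2) + (w 1 + w (-1)) *\<^sub>c 1"
proof -
  have p4: "X (k + 1) ^ 4 = X (k + 1) * X (k + 1) * (X (k + 1) * X (k + 1))"
    by (simp add: numeral_eq_Suc mult.assoc)
  have ex: "X k * X (k + 2) = w 4 *\<^sub>c X (k + 1) ^ 4 + 1"
    using exchange_even[of "k + 1"] \<open>odd k\<close> by (simp add: add.commute)
  have sq: "X (k + 1) * X (k + 1) * (X (k - 1) * X (k - 1)) = w (-4) *\<^sub>c (X k * X k) + (w (-1) + w (-3)) *\<^sub>c X k + 1"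
    using even_square_square_down[of "k + 1"] \<open>odd k\<close> by simp
  have "X k * (X (k + 1) * X (k + 1)) = w 4 *\<^sub>c (X (k + 1) * X (k + 1) * X k)"
    unfolding mult.assoc[symmetric] quasi_comm[of k] cscale_mult
    by (simp add: quasi_comm[of k] cscale_mult w_simps mult.assoc)
  then have "X k * (X (k + 1) * X (k + 1) * D) = w 4 *\<^sub>c (X (k + 1) * X (k + 1) * (X k * D))"
    by (simp add: cscale_mult flip: mult.assoc)
  also have "\<dots> = w 2 *\<^sub>c (X (k + 1) * X (k + 1) * (X (k - 1) * X (k - 1))) + w 6 *\<^sub>c X (k + 1) ^ 4"
    unfolding O p4 by (simp add: cscale_mult cscale_distrib distrib_left w_simps)
  also have "\<dots> = w (-2) *\<^sub>c (X k * X k) + w 2 *\<^sub>c (X k * X (k + 2)) + (w 1 + w (-1)) *\<^sub>c X k"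
    unfolding sq ex by (simp add: cscale_distrib w_simps algebra_simps)
  also have "\<dots> = X k * (w (-2) *\<^sub>c X k + w 2 *\<^sub>c X (k + 2) + (w 1 + w (-1)) *\<^sub>c 1)"
    by (simp add: cscale_mult distrib_left)
  finally show ?thesis by (rule cancel)
qed

end

section \<open>The right action of \<open>D\<close> and the products
  \<open>X m * Fd n\<close>\<close>

locale cluster_relations = cluster_exchange w X
  for w :: "int \<Rightarrow> 'a::ring_1 center" and X :: "int \<Rightarrow> 'a" +
  fixes D :: 'a
  assumes even_D: "even k \<Longrightarrow> X k * D = w (-1) *\<^sub>c X (k - 2) + w 1 *\<^sub>c X (k + 2)"
    and even_square_D: "even k \<Longrightarrow>
      X k * X k * D = w (-2) *\<^sub>c X (k - 1) + w 2 *\<^sub>c X (k + 1) + (w 1 + w (-1)) *\<^sub>c 1"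
    and odd_D: "odd k \<Longrightarrow> X k * D = w (-2) *\<^sub>c (X (k - 1) * X (k - 1)) + w 2 *\<^sub>c (X (k + 1) * X (k + 1))"
begin

abbreviation Fd :: "int \<Rightarrow> 'a" where "Fd \<equiv> Fcheb D"

definition Y :: "int \<Rightarrow> 'a" where
  "Y k = X k ^ ang k"

lemma Y_odd: "odd k \<Longrightarrow> Y k = X k" and Y_even: "even k \<Longrightarrow> Y k = X k * X k"
  by (simp_all add: Y_def ang_def power2_eq_square)

text \<open>Passing to \<open>Y\<close> merges the two parities into one three-term relation; only a
  scalar remembers whether \<open>k\<close> is even.\<close>

lemma Y_D:
  "Y k * D = w (-2) *\<^sub>c Y (k - 1) + w 2 *\<^sub>c Y (k + 1) + (if even k then (w 1 + w (-1)) *\<^sub>c 1 else 0)"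
  by (cases "even k") (simp_all add: Y_even Y_odd even_square_D odd_D)

text \<open>Replacing \<open>F 0 = 1\<close> by 2 makes the three-term recursion, and with it the
  product formulas, valid down to \<open>n = 0\<close>.\<close>

definition C :: "int \<Rightarrow> 'a" where
  "C n = Fd n + of_bool (n = 0)"

lemma C_step: "1 \<le> n \<Longrightarrow> C (n + 1) = C n * D - C (n - 1)"
  using Fcheb_mult[of D n] by (simp add: C_def algebra_simps)

lemma C_01 [simp]: "C 0 = 2" "C 1 = D"
  by (simp_all add: C_def)

lemma even_C:
  assumes "even m" "0 \<le> n"
  shows "X m * C n = w (-n) *\<^sub>c X (m - 2 * n) + w n *\<^sub>c X (m + 2 * n)"
  using assms(2)
proof (induction n rule: int_two_step_induct)
  case zero
  show ?case by (simp add: mult_2_right)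
next
  case one
  show ?case using even_D[OF assms(1)] by simp
next
  case (step n)
  have "X m * C (n + 1) = X m * C n * D - X m * C (n - 1)"
    by (simp add: C_step[OF step.hyps] right_diff_distrib mult.assoc)
  also have "\<dots> = w (-n) *\<^sub>c (X (m - 2 * n) * D) + w n *\<^sub>c (X (m + 2 * n) * D)
     - (w (1 - n) *\<^sub>c X (m - 2 * (n - 1)) + w (n - 1) *\<^sub>c X (m + 2 * (n - 1)))"
    using step by (simp add: cscale_mult distrib_right)
  also have "\<dots> = w (-(n + 1)) *\<^sub>c X (m - 2 * (n + 1)) + w (n + 1) *\<^sub>c X (m + 2 * (n + 1))"
    using assms(1) by (simp add: even_D cscale_distrib w_simps algebra_simps)
  finally show ?case .
qed

lemma even_F:
  assumes "even m" "0 < n"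
  shows "X m * Fd n = w (-n) *\<^sub>c X (m - 2 * n) + w n *\<^sub>c X (m + 2 * n)"
  using even_C[OF assms(1), of n] assms(2) by (simp add: C_def)

definition s_coef :: "int \<Rightarrow> 'a center" where
  "s_coef k = (\<Sum>l\<in>{1..k}. w (- (4 * l - 1)) + w (- (4 * l - 3)) + w (4 * l - 3) + w (4 * l - 1))"

lemma s_coef_0 [simp]: "s_coef 0 = 0"
  by (simp add: s_coef_def)

lemma s_coef_step:
  "1 \<le> k \<Longrightarrow> s_coef k = s_coef (k - 1) + (w (- (4 * k - 1)) + w (- (4 * k - 3)) + w (4 * k - 3) + w (4 * k - 1))"
  unfolding s_coef_def by (rule sum_atLeastAtMost_int_Suc)

text \<open>In the induction step the corrections of \<open>cheb_sum_mult\<close> occur for odd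
  \<open>n\<close>, and so do the scalars of \<open>Y_D\<close>, because \<open>m\<close> is odd.
  They cancel: for \<open>n = 2 * k - 1\<close>, the four terms added in \<open>s_coef k\<close> are
  the product of \<open>w (-2 * n) + w (2 * n)\<close> and \<open>w 1 + w (-1)\<close>.\<close>

lemma odd_C:
  assumes "odd m" "0 \<le> n"
  shows "X m * C n = w (-2 * n) *\<^sub>c Y (m - n) + w (2 * n) *\<^sub>c Y (m + n)
    + (\<Sum>k\<in>{1..n}. s_coef k *\<^sub>c Fd (n - 2 * k))"
  using assms(2)
proof (induction n rule: int_two_step_induct)
  case zero
  show ?case using assms by (simp add: mult_2_right Y_odd)
next
  case one
  show ?case using odd_D[OF assms(1)] assms by (simp add: Y_even)
next
  case (step n)
  let ?S = "\<lambda>a. \<Sum>k\<in>{1..n + 1}. s_coef k *\<^sub>c Fd (a - 2 * k)"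
  \<comment> \<open>Both induction hypotheses are brought to the summation range of the claim; the
    added terms have negative Chebyshev index.\<close>
  have S: "(\<Sum>k\<in>{1..n - 1}. s_coef k *\<^sub>c Fd (n - 1 - 2 * k)) = ?S (n - 1)"
    "(\<Sum>k\<in>{1..n}. s_coef k *\<^sub>c Fd (n - 2 * k)) = ?S n"
    by (rule cheb_sum_extend[symmetric]; use step.hyps in simp)+
  have SD: "?S n * D = ?S (n + 1) + ?S (n - 1)
     + (if odd n then (s_coef ((n - 1) div 2) - s_coef ((n + 1) div 2)) *\<^sub>c 1 else 0)"
    by (rule cheb_sum_mult) (use step.hyps in simp_all)
  have cancel: "(if odd n then (s_coef ((n - 1) div 2) - s_coef ((n + 1) div 2)) *\<^sub>c 1 else 0)
      + (w (-2 * n) + w (2 * n)) *\<^sub>c (if even (m + n) then (w 1 + w (-1)) *\<^sub>c 1 else 0) = (0::'a)"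
  proof (cases "odd n")
    case True
    then obtain r where r: "n = 2 * r + 1" by (elim oddE)
    have "s_coef (r + 1) = s_coef r + (w (- (4 * r + 3)) + w (- (4 * r + 1)) + w (4 * r + 1) + w (4 * r + 3))"
      using s_coef_step[of "r + 1"] r step.hyps by (simp add: algebra_simps)
    then show ?thesis using assms(1) r
      by (simp add: cscale_distrib w_simps algebra_simps)
  qed (use assms in simp)
  have "X m * C (n + 1) = X m * C n * D - X m * C (n - 1)"
    by (simp add: C_step[OF step.hyps] right_diff_distrib mult.assoc)
  also have "\<dots> = w (-2 * n) *\<^sub>c (Y (m - n) * D) + w (2 * n) *\<^sub>c (Y (m + n) * D) + ?S n * D
     - (w (-2 * (n - 1)) *\<^sub>c Y (m - (n - 1)) + w (2 * (n - 1)) *\<^sub>c Y (m + (n - 1)) + ?S (n - 1))"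
    using step by (simp add: S cscale_mult distrib_right)
  also have "\<dots> = w (-2 * (n + 1)) *\<^sub>c Y (m - (n + 1)) + w (2 * (n + 1)) *\<^sub>c Y (m + (n + 1)) + ?S (n + 1)
      + ((if odd n then (s_coef ((n - 1) div 2) - s_coef ((n + 1) div 2)) *\<^sub>c 1 else 0)
      + (w (-2 * n) + w (2 * n)) *\<^sub>c (if even (m + n) then (w 1 + w (-1)) *\<^sub>c 1 else 0))"
    unfolding SD Y_D by (simp add: cscale_distrib w_simps algebra_simps)
  finally show ?case unfolding cancel by simp
qed

lemma odd_F:
  assumes "odd m" "0 < n"
  shows "X m * Fd n = w (-2 * n) *\<^sub>c Y (m - n) + w (2 * n) *\<^sub>c Y (m + n)
    + (\<Sum>k\<in>{1..n}. s_coef k *\<^sub>c Fd (n - 2 * k))"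
  using odd_C[OF assms(1), of n] assms(2) by (simp add: C_def)

text \<open>The relation \<open>even_D\<close> solved for \<open>X (k + 2)\<close>: it drives the
  inductions on the distance between the two factors when the right factor has even index.\<close>

lemma mult_even_rec:
  assumes "even k"
  shows "Z * X (k + 2) = w (-1) *\<^sub>c (Z * X k * D) - w (-2) *\<^sub>c (Z * X (k - 2))"
  by (simp add: even_D[OF assms] mult.assoc cscale_expand w_simps)

section \<open>Products of two even cluster variables\<close>

definition t_coef :: "int \<Rightarrow> 'a center" where
  "t_coef k = (\<Sum>l\<in>{1..2 * k - 1}. w (2 * l))"

lemma t_coef_0 [simp]: "t_coef 0 = 0"
  by (simp add: t_coef_def)

lemma t_coef_step:
  assumes "1 \<le> k"
  shows "t_coef (k + 1) = t_coef k + w (4 * k) + w (4 * k + 2)"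
proof -
  have "(\<Sum>l\<in>{1..2 * k + 1}. w (2 * l)) = (\<Sum>l\<in>{1..2 * k - 1}. w (2 * l)) + w (2 * (2 * k)) + w (2 * (2 * k + 1))"
    using assms sum_atLeastAtMost_int_Suc[of 1 "2 * k + 1" "\<lambda>l. w (2 * l)"]
      sum_atLeastAtMost_int_Suc[of 1 "2 * k" "\<lambda>l. w (2 * l)"] by simp
  then show ?thesis by (simp add: t_coef_def algebra_simps)
qed

text \<open>With \<open>w (- (n + 1))\<close> pulled out, the coefficients \<open>t_coef k\<close>
  no longer depend on \<open>n\<close>, so the Chebyshev sums satisfy the recursion up to scalars.
  For even \<open>n\<close> these scalars cancel against those of \<open>Y_D\<close> by
  \<open>t_coef_step\<close>; for odd \<open>n\<close> there are none. The start is
  \<open>X m * X m\<close> and an exchange relation.\<close>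

lemma even_even_aux:
  assumes "even m" "0 \<le> n"
  shows "X m * X (m + 2 * n) = w n *\<^sub>c Y (m + n)
    + w (- (n + 1)) *\<^sub>c (\<Sum>k\<in>{1..n}. t_coef k *\<^sub>c Fd (n + 1 - 2 * k))"
  using assms(2)
proof (induction n rule: int_two_step_induct)
  case zero
  show ?case using assms by (simp add: Y_even)
next
  case one
  show ?case using exchange_odd[of "m + 1"] assms by (simp add: Y_odd t_coef_def w_simps add.commute)
next
  case (step n)
  let ?S = "\<lambda>a. \<Sum>k\<in>{1..n + 1}. t_coef k *\<^sub>c Fd (a - 2 * k)"
  have S: "(\<Sum>k\<in>{1..n - 1}. t_coef k *\<^sub>c Fd (n - 2 * k)) = ?S n"
    "(\<Sum>k\<in>{1..n}. t_coef k *\<^sub>c Fd (n + 1 - 2 * k)) = ?S (n + 1)"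
    by (rule cheb_sum_extend[symmetric]; use step.hyps in simp)+
  have SD: "?S (n + 1) * D = ?S (n + 1 + 1) + ?S (n + 1 - 1)
     + (if odd (n + 1) then (t_coef ((n + 1 - 1) div 2) - t_coef ((n + 1 + 1) div 2)) *\<^sub>c 1 else 0)"
    by (rule cheb_sum_mult) (use step.hyps in simp_all)
  have cancel: "w (-2 - n) *\<^sub>c (if odd (n + 1) then (t_coef ((n + 1 - 1) div 2) - t_coef ((n + 1 + 1) div 2)) *\<^sub>c 1 else 0)
      + w (n - 1) *\<^sub>c (if even (m + n) then (w 1 + w (-1)) *\<^sub>c 1 else 0) = (0::'a)"
  proof (cases "even n")
    case True
    then obtain r where r: "n = 2 * r" by (elim evenE)
    then show ?thesis using assms(1) step.hyps t_coef_step[of r]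
      by (simp add: cscale_distrib w_simps algebra_simps)
  qed (use assms in simp)
  have IH: "X m * X (m + 2 * n) = w n *\<^sub>c Y (m + n) + w (- (n + 1)) *\<^sub>c ?S (n + 1)"
    "X m * X (m + 2 * (n - 1)) = w (n - 1) *\<^sub>c Y (m + (n - 1)) + w (- n) *\<^sub>c ?S n"
    using step.IH by (simp_all add: S)
  have "X m * X (m + 2 * (n + 1)) = w (-1) *\<^sub>c (X m * X (m + 2 * n) * D)
      - w (-2) *\<^sub>c (X m * X (m + 2 * (n - 1)))"
    using mult_even_rec[of "m + 2 * n" "X m"] assms(1) by (simp add: algebra_simps)
  also have "\<dots> = w (n - 1) *\<^sub>c (Y (m + n) * D) + w (-2 - n) *\<^sub>c (?S (n + 1) * D)
     - (w (n - 3) *\<^sub>c Y (m + (n - 1)) + w (-2 - n) *\<^sub>c ?S n)"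
    unfolding IH by (simp add: cscale_mult cscale_distrib distrib_right w_simps)
  also have "\<dots> = w (n + 1) *\<^sub>c Y (m + (n + 1)) + w (-2 - n) *\<^sub>c ?S (n + 1 + 1)
      + (w (-2 - n) *\<^sub>c (if odd (n + 1) then (t_coef ((n + 1 - 1) div 2) - t_coef ((n + 1 + 1) div 2)) *\<^sub>c 1 else 0)
      + w (n - 1) *\<^sub>c (if even (m + n) then (w 1 + w (-1)) *\<^sub>c 1 else 0))"
    unfolding SD Y_D by (simp add: cscale_distrib w_simps algebra_simps)
  finally have "X m * X (m + 2 * (n + 1)) = w (n + 1) *\<^sub>c Y (m + (n + 1)) + w (-2 - n) *\<^sub>c ?S (n + 1 + 1)"
    unfolding cancel by simp
  moreover have "- (n + 1 + 1) = -2 - n" by simp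
  ultimately show ?case by simp
qed

lemma even_even:
  assumes "even m" "0 \<le> n"
  shows "X m * X (m + 2 * n) = w n *\<^sub>c Y (m + n)
    + (\<Sum>k\<in>{1..n}. (\<Sum>l\<in>{1..2 * k - 1}. w (- (n + 1) + 2 * l)) *\<^sub>c Fd (n - 2 * k + 1))"
proof -
  have "w (- (n + 1)) * t_coef k = (\<Sum>l\<in>{1..2 * k - 1}. w (- (n + 1) + 2 * l))" for k
    unfolding t_coef_def sum_distrib_left w_mult ..
  then show ?thesis
    using even_even_aux[OF assms] by (simp add: cscale_sum_right algebra_simps)
qed

section \<open>Products of an odd and an even cluster variable\<close>

definition G :: "int \<Rightarrow> 'a center" where
  "G M = (\<Sum>l\<in>{1..M}. w (2 * l))"

lemma G_nonpos [simp]: "M \<le> 0 \<Longrightarrow> G M = 0"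
  by (simp add: G_def)

lemma G_step: "1 \<le> M \<Longrightarrow> G M = G (M - 1) + w (2 * M)"
  unfolding G_def by (rule sum_atLeastAtMost_int_Suc)

text \<open>Writing the coefficient as a monomial times a partial geometric sum reduces the
  comparison of coefficients to that of the upper limits. Since \<open>G\<close> vanishes for
  nonpositive limits, sums over \<open>k\<close> may be extended and shifted freely.\<close>

definition c_coef :: "int \<Rightarrow> int \<Rightarrow> 'a center" where
  "c_coef n k = w (-1 - 2 * k) * G (min (4 * k) (n - 2 * k))"

lemma c_coef_eq_0 [simp]: "k \<le> 0 \<Longrightarrow> c_coef n k = 0" "n \<le> 2 * k \<Longrightarrow> c_coef n k = 0"
  by (simp_all add: c_coef_def)

lemma c_coef_eq: "c_coef n k = (\<Sum>l\<in>{1..min (4 * k) (n - 2 * k)}. w (-1 - 2 * k + 2 * l))"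
  by (simp add: c_coef_def G_def sum_distrib_left w_mult)

text \<open>The last summand of part (3), for \<open>j = m - n\<close>. As a recursion in \<open>n\<close> of step 2, part (3)
  starts at \<open>n = -1\<close> and \<open>n = 1\<close>; \<open>defect n\<close> measures how far \<open>lead\<close> is from satisfying it.\<close>

definition lead :: "int \<Rightarrow> int \<Rightarrow> 'a" where
  "lead j n = (if n mod 3 = 0 then w n *\<^sub>c X (j + n div 3) ^ 3
     else w (n - 1) *\<^sub>c (X (j + n div 3) * X (j + n div 3 + 1)))"

definition defect :: "int \<Rightarrow> 'a center" where
  "defect n = (if n mod 3 = 1 then w (n - 2) else if n mod 3 = 0 then w n + w (n - 2) else w n)"

text \<open>The residues are represented so that \<open>k = (n + 5) div 6\<close> in all three
  cases; this is the only index at which the recursion for \<open>c_coef\<close> has a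
  defect.\<close>

lemma odd_mod_6_cases:
  assumes "odd (n::int)"
  obtains k where "n = 6 * k - 5" | k where "n = 6 * k - 3" | k where "n = 6 * k - 1"
proof -
  have "n = 6 * ((n + 5) div 6) - 5 \<or> n = 6 * ((n + 5) div 6) - 3 \<or> n = 6 * ((n + 5) div 6) - 1"
    using assms by presburger
  then show ?thesis using that by metis
qed

text \<open>All four terms carry the factor \<open>w (-1 - 2 * k)\<close>, so only values of
  \<open>G\<close> are compared. The minimum in the upper limit changes its branch at
  \<open>n = 6 * k\<close>; away from it the values cancel in pairs, and in the three cases just
  below it one or two summands of \<open>G\<close> remain, which form
  \<open>defect n\<close>.\<close>

lemma c_coef_rec:
  assumes "odd n" "1 \<le> n" "1 \<le> k"
  shows "c_coef n k + w (-2) * c_coef n (k - 1) - w (-2) * c_coef (n - 2) (k - 1)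
    = c_coef (n + 2) k - (if k = (n + 5) div 6 then defect n else 0)"
proof -
  have e: "c_coef n k = w (-1 - 2 * k) * G (min (4 * k) (n - 2 * k))"
    "w (-2) * c_coef n (k - 1) = w (-1 - 2 * k) * G (min (4 * k - 4) (n - 2 * k + 2))"
    "w (-2) * c_coef (n - 2) (k - 1) = w (-1 - 2 * k) * G (min (4 * k - 4) (n - 2 * k))"
    "c_coef (n + 2) k = w (-1 - 2 * k) * G (min (4 * k) (n - 2 * k + 2))"
    by (simp_all add: c_coef_def w_simps algebra_simps)
  have "n \<le> 6 * k - 6 \<or> n = 6 * k - 5 \<or> n = 6 * k - 3 \<or> n = 6 * k - 1 \<or> 6 * k \<le> n"
    using assms(1) by presburger
  then consider "n \<le> 6 * k - 6" | "n = 6 * k - 5" | "n = 6 * k - 3" | "n = 6 * k - 1" | "6 * k \<le> n"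
    by blast
  then show ?thesis
  proof cases
    case 1
    moreover from 1 have "n \<le> 6 * k - 7" using assms(1) by presburger
    moreover from this have "k \<noteq> (n + 5) div 6" by presburger
    ultimately show ?thesis unfolding e by (simp add: min_def)
  next
    case 2
    then have "(n + 5) div 6 = k" "n mod 3 = 1" by presburger+
    then have d: "(n + 5) div 6 = k" "defect n = w (6 * k - 7)"
      using 2 by (simp_all add: defect_def)
    have m: "min (4 * k) (n - 2 * k) = 4 * k - 5" "min (4 * k - 4) (n - 2 * k + 2) = 4 * k - 4"
      "min (4 * k - 4) (n - 2 * k) = 4 * k - 5" "min (4 * k) (n - 2 * k + 2) = 4 * k - 3"
      using 2 by simp_all
    show ?thesis unfolding e d m using assms(3) G_step[of "4 * k - 3"]
      by (simp add: w_simps algebra_simps)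
  next
    case 3
    then have "(n + 5) div 6 = k" "n mod 3 = 0" by presburger+
    then have d: "(n + 5) div 6 = k" "defect n = w (6 * k - 3) + w (6 * k - 5)"
      using 3 by (simp_all add: defect_def)
    have m: "min (4 * k) (n - 2 * k) = 4 * k - 3" "min (4 * k - 4) (n - 2 * k + 2) = 4 * k - 4"
      "min (4 * k - 4) (n - 2 * k) = 4 * k - 4" "min (4 * k) (n - 2 * k + 2) = 4 * k - 1"
      using 3 by simp_all
    show ?thesis unfolding e d m using assms(3) G_step[of "4 * k - 1"] G_step[of "4 * k - 2"]
      by (simp add: w_simps algebra_simps)
  next
    case 4
    then have "(n + 5) div 6 = k" "n mod 3 = 2" by presburger+
    then have d: "(n + 5) div 6 = k" "defect n = w (6 * k - 1)"
      using 4 by (simp_all add: defect_def)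
    have m: "min (4 * k) (n - 2 * k) = 4 * k - 1" "min (4 * k - 4) (n - 2 * k + 2) = 4 * k - 4"
      "min (4 * k - 4) (n - 2 * k) = 4 * k - 4" "min (4 * k) (n - 2 * k + 2) = 4 * k"
      using 4 by simp_all
    show ?thesis unfolding e d m using assms(3) G_step[of "4 * k"]
      by (simp add: w_simps algebra_simps)
  next
    case 5
    then have "k \<noteq> (n + 5) div 6" using assms(1) by presburger
    then show ?thesis unfolding e using 5 by (simp add: min_def)
  qed
qed

text \<open>In each residue class \<open>D\<close> can be made to act on an odd variable or on the
  square of an even one. Products of variables at distance 2 are then lowered by an exchange
  relation, whose constant term contributes to the defect; in the cubic case the scalar in
  \<open>even_square_D\<close> does so.\<close>

lemma lead_rec:
  assumes "odd j" "odd n"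
  shows "w (-1) *\<^sub>c (lead j n * D) - w (-2) *\<^sub>c lead j (n - 2)
    = lead j (n + 2) + defect n *\<^sub>c X (j + n + 2 - 4 * ((n + 5) div 6))"
  using assms(2)
proof (cases rule: odd_mod_6_cases)
  case (1 k)
  define a where "a = j + 2 * k - 2"
  have "odd a" using assms(1) by (simp add: a_def)
  have d: "n mod 3 = 1" "n div 3 = 2 * k - 2" "(n + 2) mod 3 = 0" "(n + 2) div 3 = 2 * k - 1"
    "(n - 2) mod 3 = 2" "(n - 2) div 3 = 2 * k - 3" "(n + 5) div 6 = k"
    using 1 by presburger+
  have l: "lead j n = w (n - 1) *\<^sub>c (X a * X (a + 1))" "lead j (n + 2) = w (n + 2) *\<^sub>c X (a + 1) ^ 3"
    "lead j (n - 2) = w (n - 3) *\<^sub>c (X (a - 1) * X a)"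
    using 1 by (simp_all add: lead_def d a_def algebra_simps)
  have i: "j + n + 2 - 4 * k = a - 1" using 1 by (simp add: a_def)
  \<comment> \<open>The odd variable has to stand next to \<open>D\<close>, so the factors appear in
    reversed order; \<open>quasi_comm\<close> restores the order afterwards.\<close>
  have "X (a + 1) * X a * D = w (-2) *\<^sub>c (X (a + 1) * X (a - 1) * X (a - 1)) + w 2 *\<^sub>c X (a + 1) ^ 3"
    using odd_D[OF \<open>odd a\<close>] by (simp add: mult.assoc cscale_expand power3_eq_cube)
  also have "\<dots> = w (-3) *\<^sub>c (X a * X (a - 1)) + w (-2) *\<^sub>c X (a - 1) + w 2 *\<^sub>c X (a + 1) ^ 3"
    by (simp add: exchange_odd'[OF \<open>odd a\<close>] cscale_expand w_simps)
  also have "X a * X (a - 1) = w (-2) *\<^sub>c (X (a - 1) * X a)"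
    using quasi_comm'[of "a - 1"] by simp
  finally have "X a * X (a + 1) * D =
      w 2 *\<^sub>c (w (-3) *\<^sub>c w (-2) *\<^sub>c (X (a - 1) * X a) + w (-2) *\<^sub>c X (a - 1) + w 2 *\<^sub>c X (a + 1) ^ 3)"
    using quasi_comm[of a] by (simp add: cscale_mult)
  then show ?thesis
    unfolding d l i defect_def by (simp add: cscale_expand w_simps add.commute)
next
  case (2 k)
  define a where "a = j + 2 * k - 1"
  have "even a" using assms(1) by (simp add: a_def)
  have d: "n mod 3 = 0" "n div 3 = 2 * k - 1" "(n + 2) mod 3 = 2" "(n + 2) div 3 = 2 * k - 1"
    "(n - 2) mod 3 = 1" "(n - 2) div 3 = 2 * k - 2" "(n + 5) div 6 = k"
    using 2 by presburger+
  have l: "lead j n = w n *\<^sub>c X a ^ 3" "lead j (n + 2) = w (n + 1) *\<^sub>c (X a * X (a + 1))"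
    "lead j (n - 2) = w (n - 3) *\<^sub>c (X (a - 1) * X a)"
    using 2 by (simp_all add: lead_def d a_def algebra_simps)
  have i: "j + n + 2 - 4 * k = a" using 2 by (simp add: a_def)
  have "X a ^ 3 * D = X a * (X a * X a * D)"
    by (simp add: power3_eq_cube mult.assoc)
  also have "\<dots> = w (-2) *\<^sub>c (X a * X (a - 1)) + w 2 *\<^sub>c (X a * X (a + 1)) + (w 1 + w (-1)) *\<^sub>c X a"
    unfolding even_square_D[OF \<open>even a\<close>] by (simp add: cscale_expand)
  also have "X a * X (a - 1) = w (-2) *\<^sub>c (X (a - 1) * X a)"
    using quasi_comm'[of "a - 1"] by simp
  finally show ?thesis
    unfolding d l i defect_def by (simp add: cscale_expand w_simps add.commute)
next
  case (3 k)
  define a where "a = j + 2 * k - 1"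
  have "even a" using assms(1) by (simp add: a_def)
  have d: "n mod 3 = 2" "n div 3 = 2 * k - 1" "(n + 2) mod 3 = 1" "(n + 2) div 3 = 2 * k"
    "(n - 2) mod 3 = 0" "(n - 2) div 3 = 2 * k - 1" "(n + 5) div 6 = k"
    using 3 by presburger+
  have l: "lead j n = w (n - 1) *\<^sub>c (X a * X (a + 1))" "lead j (n + 2) = w (n + 1) *\<^sub>c (X (a + 1) * X (a + 2))"
    "lead j (n - 2) = w (n - 2) *\<^sub>c X a ^ 3"
    using 3 by (simp_all add: lead_def d a_def algebra_simps)
  have i: "j + n + 2 - 4 * k = a + 2" using 3 by (simp add: a_def)
  have "X a * X (a + 1) * D = w (-2) *\<^sub>c X a ^ 3 + w 2 *\<^sub>c (X a * X (a + 2) * X (a + 2))"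
    using odd_D[of "a + 1"] \<open>even a\<close> by (simp add: mult.assoc cscale_expand power3_eq_cube add.commute)
  also have "X a * X (a + 2) = w 1 *\<^sub>c X (a + 1) + 1"
    using exchange_odd[of "a + 1"] \<open>even a\<close> by (simp add: add.commute)
  finally show ?thesis
    unfolding d l i defect_def by (simp add: cscale_expand w_simps add.commute)
qed

lemma c_sum_extend:
  assumes "n \<le> 2 * M + 2" "M \<le> N"
  shows "(\<Sum>k\<in>{1..N}. c_coef n k *\<^sub>c f k) = (\<Sum>k\<in>{1..M}. c_coef n k *\<^sub>c f k)"
  by (rule sum.mono_neutral_right) (use assms in auto)

text \<open>Aligns the sums on the same cluster variables. The end terms vanish because
  \<open>c_coef n 0\<close> and \<open>c_coef n N\<close> are 0.\<close>

lemma c_sum_shift: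
  assumes "n \<le> 2 * N"
  shows "(\<Sum>k\<in>{1..N}. c_coef n k *\<^sub>c X (i - 4 * k)) = (\<Sum>k\<in>{1..N}. c_coef n (k - 1) *\<^sub>c X (i + 4 - 4 * k))"
proof -
  have "(\<Sum>k\<in>{1..N}. c_coef n k *\<^sub>c X (i - 4 * k)) = (\<Sum>k\<in>{2..N+1}. c_coef n (k - 1) *\<^sub>c X (i + 4 - 4 * k))"
    by (rule sum.reindex_bij_witness[of _ "\<lambda>k. k - 1" "\<lambda>k. k + 1"]) (auto simp: algebra_simps)
  also have "\<dots> = (\<Sum>k\<in>{1..N+1}. c_coef n (k - 1) *\<^sub>c X (i + 4 - 4 * k))"
    by (rule sum.mono_neutral_left) auto
  also have "\<dots> = (\<Sum>k\<in>{1..N}. c_coef n (k - 1) *\<^sub>c X (i + 4 - 4 * k))"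
    by (rule sum.mono_neutral_right) (use assms in auto)
  finally show ?thesis .
qed

text \<open>The recursion of \<open>mult_even_rec\<close> is evaluated separately on the sum and on
  \<open>lead\<close>: the first misses the next sum by \<open>defect n\<close> times one variable,
  the second exceeds the next \<open>lead\<close> by the same term. At \<open>r = 0\<close> the
  claim is a quasi-commutation relation, at \<open>r = 1\<close> it is trivial.\<close>

lemma odd_even_aux:
  assumes "odd j" "0 \<le> r"
  shows "X j * X (j + (2 * r - 1)) =
    (\<Sum>k\<in>{1..r}. c_coef (2 * r - 1) k *\<^sub>c X (j + (2 * r - 1) - 4 * k)) + lead j (2 * r - 1)"
  using assms(2)
proof (induction r rule: int_two_step_induct)
  case zero
  show ?case using quasi_comm'[of "j - 1"] by (simp add: lead_def)
next
  case one
  show ?case by (simp add: lead_def)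
next
  case (step r)
  define n where "n = 2 * r - 1"
  have n: "odd n" "1 \<le> n" using step.hyps by (simp_all add: n_def)
  let ?S = "\<lambda>b. \<Sum>k\<in>{1..r + 1}. c_coef b k *\<^sub>c X (j + b - 4 * k)"
  have "(\<Sum>k\<in>{1..r}. c_coef n k *\<^sub>c X (j + n - 4 * k)) = ?S n"
    by (rule c_sum_extend[symmetric]) (simp_all add: n_def)
  then have IH1: "X j * X (j + n) = ?S n + lead j n"
    using step.IH(2) by (simp flip: n_def)
  have "(\<Sum>k\<in>{1..r-1}. c_coef (n - 2) k *\<^sub>c X (j + (n - 2) - 4 * k)) = ?S (n - 2)"
    by (rule c_sum_extend[symmetric]) (simp_all add: n_def)
  moreover have n2: "2 * (r - 1) - 1 = n - 2" by (simp add: n_def)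
  ultimately have IH2: "X j * X (j + (n - 2)) = ?S (n - 2) + lead j (n - 2)"
    using step.IH(1) unfolding n2 by simp
  have bounds: "n \<le> 2 * (r + 1)" "n - 2 \<le> 2 * (r + 1)"
    by (simp_all add: n_def)
  have e: "j + n - 2 + 4 - 4 * k = j + n + 2 - 4 * k" "j + (n - 2) + 4 - 4 * k = j + n + 2 - 4 * k" for k
    by simp_all
  have single: "(\<Sum>k\<in>{1..r + 1}. if k = (n + 5) div 6 then defect n *\<^sub>c X (j + n + 2 - 4 * k) else 0)
      = defect n *\<^sub>c X (j + n + 2 - 4 * ((n + 5) div 6))"
  proof -
    have "1 \<le> (n + 5) div 6" "(n + 5) div 6 \<le> r + 1"
      using step.hyps unfolding n_def by presburger+
    then show ?thesis by (simp add: sum.delta)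
  qed
  have shift: "(\<Sum>k\<in>{1..r + 1}. c_coef n k *\<^sub>c X (j + n - 2 - 4 * k))
        = (\<Sum>k\<in>{1..r + 1}. c_coef n (k - 1) *\<^sub>c X (j + n + 2 - 4 * k))"
      "?S (n - 2) = (\<Sum>k\<in>{1..r + 1}. c_coef (n - 2) (k - 1) *\<^sub>c X (j + n + 2 - 4 * k))"
    using c_sum_shift[OF bounds(1), of "j + n - 2"] c_sum_shift[OF bounds(2), of "j + (n - 2)"]
    unfolding e .
  have "w (-1) *\<^sub>c (c_coef n k *\<^sub>c X (j + n - 4 * k) * D)
      = c_coef n k *\<^sub>c X (j + n + 2 - 4 * k) + w (-2) *\<^sub>c (c_coef n k *\<^sub>c X (j + n - 2 - 4 * k))" for k
  proof -
    have e: "j + n - 4 * k - 2 = j + n - 2 - 4 * k" "j + n - 4 * k + 2 = j + n + 2 - 4 * k" by simp_all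
    have "X (j + n - 4 * k) * D = w (-1) *\<^sub>c X (j + n - 2 - 4 * k) + w 1 *\<^sub>c X (j + n + 2 - 4 * k)"
      using even_D[of "j + n - 4 * k", unfolded e] assms(1) n(1) by simp
    then show ?thesis
      by (simp add: cscale_mult cscale_distrib mult.commute[of "c_coef n k"] w_simps)
  qed
  then have SD: "w (-1) *\<^sub>c (?S n * D)
      = (\<Sum>k\<in>{1..r + 1}. c_coef n k *\<^sub>c X (j + n + 2 - 4 * k)) + w (-2) *\<^sub>c (\<Sum>k\<in>{1..r + 1}. c_coef n k *\<^sub>c X (j + n - 2 - 4 * k))"
    by (simp only: sum_distrib_right cscale_sum_right sum.distrib)
  have "w (-1) *\<^sub>c (?S n * D) - w (-2) *\<^sub>c ?S (n - 2) = (\<Sum>k\<in>{1..r + 1}. (c_coef n k + w (-2) * c_coef n (k - 1)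
       - w (-2) * c_coef (n - 2) (k - 1)) *\<^sub>c X (j + n + 2 - 4 * k))"
    unfolding SD shift
    by (simp only: cscale_distrib cscale_sum_right cscale_simps sum.distrib sum_subtractf)
  also have "\<dots> = (\<Sum>k\<in>{1..r + 1}. (c_coef (n + 2) k - (if k = (n + 5) div 6 then defect n else 0))
       *\<^sub>c X (j + n + 2 - 4 * k))"
    by (rule sum.cong) (simp_all only: c_coef_rec[OF n] atLeastAtMost_iff)
  also have "\<dots> = ?S (n + 2) - (\<Sum>k\<in>{1..r + 1}. if k = (n + 5) div 6 then defect n *\<^sub>c X (j + n + 2 - 4 * k) else 0)"
    unfolding sum_subtractf[symmetric]
    by (rule sum.cong) (auto simp: cscale_distrib add.assoc)
  finally have S: "w (-1) *\<^sub>c (?S n * D) - w (-2) *\<^sub>c ?S (n - 2)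
     = ?S (n + 2) - defect n *\<^sub>c X (j + n + 2 - 4 * ((n + 5) div 6))"
    unfolding single .
  have "X j * X (j + n + 2) = w (-1) *\<^sub>c (X j * X (j + n) * D) - w (-2) *\<^sub>c (X j * X (j + (n - 2)))"
    using mult_even_rec[of "j + n" "X j"] assms(1) n(1) by (simp add: add_diff_eq)
  also have "\<dots> = (w (-1) *\<^sub>c (?S n * D) - w (-2) *\<^sub>c ?S (n - 2)) + (w (-1) *\<^sub>c (lead j n * D) - w (-2) *\<^sub>c lead j (n - 2))"
    unfolding IH1 IH2 distrib_right cscale_distrib by simp
  also have "\<dots> = ?S (n + 2) + lead j (n + 2)"
    unfolding S lead_rec[OF assms(1) n(1)] by simp
  finally have "X j * X (j + (n + 2)) = ?S (n + 2) + lead j (n + 2)" by (simp add: add.assoc)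
  moreover have "2 * (r + 1) - 1 = n + 2" by (simp add: n_def)
  ultimately show ?case by (simp only:)
qed

lemma odd_even:
  assumes "even m" "odd n" "0 < n"
  shows "X (m - n) * X m =
     (\<Sum>k\<in>{k. 0 < k \<and> 1 < 2 * k \<and> 2 * k < n}.
         (\<Sum>l\<in>{1..min (4 * k) (n - 2 * k)}. w (-1 - 2 * k + 2 * l)) *\<^sub>c X (m - 4 * k))
   + (if n mod 3 = 0 then w n *\<^sub>c X (m - (2 * n) div 3) ^ 3
      else w (n - 1) *\<^sub>c (X \<lfloor>real_of_int m - 2 * real_of_int n / 3\<rfloor>
                         * X \<lceil>real_of_int m - 2 * real_of_int n / 3\<rceil>))"
proof -
  define r where "r = (n + 1) div 2"
  have r: "n = 2 * r - 1" "0 \<le> r" using assms(2,3) by (auto simp: r_def elim: oddE)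
  have "X (m - n) * X m = (\<Sum>k\<in>{1..r}. c_coef n k *\<^sub>c X (m - 4 * k)) + lead (m - n) n"
    using odd_even_aux[of "m - n" r] assms r by simp
  also have "(\<Sum>k\<in>{1..r}. c_coef n k *\<^sub>c X (m - 4 * k))
      = (\<Sum>k\<in>{k. 0 < k \<and> 1 < 2 * k \<and> 2 * k < n}. c_coef n k *\<^sub>c X (m - 4 * k))"
  proof (rule sum.mono_neutral_right)
    have "c_coef n i *\<^sub>c X (m - 4 * i) = 0" if "\<not> 2 * i < n" for i using that by simp
    then show "\<forall>i\<in>{1..r} - {k. 0 < k \<and> 1 < 2 * k \<and> 2 * k < n}. c_coef n i *\<^sub>c X (m - 4 * i) = 0"
      by fastforce
    show "{k. 0 < k \<and> 1 < 2 * k \<and> 2 * k < n} \<subseteq> {1..r}" using r by auto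
  qed simp
  also have "lead (m - n) n = (if n mod 3 = 0 then w n *\<^sub>c X (m - (2 * n) div 3) ^ 3
      else w (n - 1) *\<^sub>c (X \<lfloor>real_of_int m - 2 * real_of_int n / 3\<rfloor>
                         * X \<lceil>real_of_int m - 2 * real_of_int n / 3\<rceil>))"
  proof (cases "n mod 3 = 0")
    case True
    then have i: "m - n + n div 3 = m - (2 * n) div 3" by presburger
    show ?thesis unfolding lead_def i using True by simp
  next
    case False
    \<comment> \<open>As 3 does not divide \<open>n\<close>, the number
      \<open>m - 2 * n / 3 = (m - n) + n / 3\<close> lies strictly between \<open>m - n + a\<close>
      and its successor.\<close>
    define a where "a = n div 3"
    have a: "3 * a < n" "n < 3 * a + 3" using False unfolding a_def by presburger+
    then have "3 * real_of_int a < real_of_int n" "real_of_int n < 3 * real_of_int a + 3" by linarith+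
    then have "\<lfloor>real_of_int m - 2 * real_of_int n / 3\<rfloor> = m - n + a"
      "\<lceil>real_of_int m - 2 * real_of_int n / 3\<rceil> = m - n + a + 1"
      unfolding floor_eq_iff ceiling_eq_iff by (simp_all add: field_simps)
    then show ?thesis using False by (simp add: lead_def a_def)
  qed
  finally show ?thesis by (simp only: c_coef_eq)
qed

lemma reflect: "cluster_relations (\<lambda>j. w (- j)) (\<lambda>k. X (- k)) D"
proof -
  interpret R: cluster_exchange "\<lambda>j. w (- j)" "\<lambda>k. X (- k)"
    by (rule reflect_exchange)
  show ?thesis
  proof
    fix k :: int
    have e: "- (k + 1) = - k - 1" "- (k - 1) = - k + 1" "- (k + 2) = - k - 2" "- (k - 2) = - k + 2"
      by simp_all
    show "X (- k) * D = w (- (- 1)) *\<^sub>c X (- (k - 2)) + w (- 1) *\<^sub>c X (- (k + 2))" if "even k"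
      using even_D[of "- k"] that unfolding e by (simp add: add.commute)
    show "X (- k) * X (- k) * D = w (- (- 2)) *\<^sub>c X (- (k - 1)) + w (- 2) *\<^sub>c X (- (k + 1))
        + (w (- 1) + w (- (- 1))) *\<^sub>c 1" if "even k"
      using even_square_D[of "- k"] that unfolding e by (simp add: add.commute)
    show "X (- k) * D = w (- (- 2)) *\<^sub>c (X (- (k - 1)) * X (- (k - 1))) +
        w (- 2) *\<^sub>c (X (- (k + 1)) * X (- (k + 1)))" if "odd k"
      using odd_D[of "- k"] that unfolding e by (simp add: add.commute)
  qed
qed

text \<open>The reflection of \<open>odd_even\<close>. It exchanges floor and ceiling, so the last
  product comes out in reversed order; sorting its factors costs \<open>w (-2)\<close>, which turns
  the exponent \<open>- (n - 1)\<close> into \<open>- (n + 1)\<close>.\<close>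

lemma odd_even_reflected:
  assumes "even m" "odd n" "0 < n"
  shows "X (m + n) * X m =
     (\<Sum>k\<in>{k. 0 < k \<and> 1 < 2 * k \<and> 2 * k < n}.
         (\<Sum>l\<in>{1..min (4 * k) (n - 2 * k)}. w (1 + 2 * k - 2 * l)) *\<^sub>c X (m + 4 * k))
   + (if n mod 3 = 0 then w (- n) *\<^sub>c X (m + (2 * n) div 3) ^ 3
      else w (- (n + 1)) *\<^sub>c (X \<lfloor>real_of_int m + 2 * real_of_int n / 3\<rfloor>
                         * X \<lceil>real_of_int m + 2 * real_of_int n / 3\<rceil>))"
proof -
  interpret R: cluster_relations "\<lambda>j. w (- j)" "\<lambda>k. X (- k)" D
    by (rule reflect)
  have e: "- (- 1 - 2 * k + 2 * l) = 1 + 2 * k - 2 * l" for k l :: int by simp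
  have last: "w (- (n - 1)) *\<^sub>c (X (- \<lfloor>real_of_int (- m) - 2 * real_of_int n / 3\<rfloor>)
        * X (- \<lceil>real_of_int (- m) - 2 * real_of_int n / 3\<rceil>))
     = w (- (n + 1)) *\<^sub>c (X \<lfloor>real_of_int m + 2 * real_of_int n / 3\<rfloor>
                         * X \<lceil>real_of_int m + 2 * real_of_int n / 3\<rceil>)" if "n mod 3 \<noteq> 0"
  proof -
    define a where "a = (2 * n) div 3"
    have a: "3 * a < 2 * n" "2 * n < 3 * a + 3" using that unfolding a_def by presburger+
    then have "3 * real_of_int a < 2 * real_of_int n" "2 * real_of_int n < 3 * real_of_int a + 3" by linarith+
    then have fl: "\<lfloor>real_of_int (- m) - 2 * real_of_int n / 3\<rfloor> = - (m + a + 1)"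
      "\<lceil>real_of_int (- m) - 2 * real_of_int n / 3\<rceil> = - (m + a)"
      "\<lfloor>real_of_int m + 2 * real_of_int n / 3\<rfloor> = m + a"
      "\<lceil>real_of_int m + 2 * real_of_int n / 3\<rceil> = m + a + 1"
      unfolding floor_eq_iff ceiling_eq_iff by (simp_all add: field_simps)
    have "- (n - 1) + - 2 = - (n + 1)" by simp
    then show ?thesis unfolding fl minus_minus quasi_comm' cscale_simps w_mult by (simp only:)
  qed
  have "X (- (- m - n)) * X (- (- m)) =
     (\<Sum>k\<in>{k. 0 < k \<and> 1 < 2 * k \<and> 2 * k < n}.
         (\<Sum>l\<in>{1..min (4 * k) (n - 2 * k)}. w (- (-1 - 2 * k + 2 * l))) *\<^sub>c X (- (- m - 4 * k)))
   + (if n mod 3 = 0 then w (- n) *\<^sub>c X (- (- m - (2 * n) div 3)) ^ 3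
      else w (- (n - 1)) *\<^sub>c (X (- \<lfloor>real_of_int (- m) - 2 * real_of_int n / 3\<rfloor>)
                         * X (- \<lceil>real_of_int (- m) - 2 * real_of_int n / 3\<rceil>)))"
    by (rule R.odd_even) (use assms in simp_all)
  then show ?thesis unfolding e using last by (simp add: algebra_simps del: of_int_minus)
qed

section \<open>Products of two odd cluster variables: the action of \<open>Fd 2\<close> and the
  linear terms\<close>

abbreviation s1 :: "'a center" where "s1 \<equiv> s_coef 1"

lemma s1_eq: "s1 = w (-3) + w (-1) + w 1 + w 3"
  by (simp add: s_coef_def)

lemma cscale_two: "(2 :: 'a center) *\<^sub>c x = x + x"
proof -
  have "(1 + 1 :: 'a center) *\<^sub>c x = x + x" by (simp only: cscale_distrib cscale_simps)
  then show ?thesis by simp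
qed

text \<open>Multiplication by \<open>D\<close> turns an odd variable into squares of even ones,
  whereas \<open>Fd 2\<close> leads back to odd variables at distance 2. This gives a recursion that
  stays among odd indices.\<close>

lemma odd_F2:
  assumes "odd p"
  shows "X p * Fd 2 = w (-4) *\<^sub>c X (p - 2) + w 4 *\<^sub>c X (p + 2) + s1 *\<^sub>c 1"
proof -
  have "{1..2} = {1, 2::int}" by auto
  then show ?thesis using odd_F[OF assms, of 2] assms by (simp add: Y_odd)
qed

lemma Y_square_F2_odd:
  assumes "odd k"
  shows "Y k * Y k * Fd 2 = w (-8) *\<^sub>c (Y (k - 1) * Y (k - 1)) + w 8 *\<^sub>c (Y (k + 1) * Y (k + 1))
     + s1 *\<^sub>c X k + (w 4 + w (-4)) *\<^sub>c 1"
proof -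
  have ex: "X k * X (k + 2) = w 4 *\<^sub>c X (k + 1) ^ 4 + 1" "X k * X (k - 2) = w (-4) *\<^sub>c X (k - 1) ^ 4 + 1"
    using exchange_even[of "k + 1"] exchange_even'[of "k - 1"] assms by (simp_all add: add.commute)
  have p4: "x ^ 4 = x * x * (x * x)" for x :: 'a
    by (simp add: numeral_eq_Suc mult.assoc)
  have "X k * X k * Fd 2 = w (-4) *\<^sub>c (X k * X (k - 2)) + w 4 *\<^sub>c (X k * X (k + 2)) + s1 *\<^sub>c X k"
    using odd_F2[OF assms] by (simp add: mult.assoc cscale_expand)
  also have "\<dots> = w (-8) *\<^sub>c X (k - 1) ^ 4 + w 8 *\<^sub>c X (k + 1) ^ 4 + s1 *\<^sub>c X k + (w 4 + w (-4)) *\<^sub>c 1"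
    unfolding ex by (simp add: cscale_distrib w_simps)
  finally show ?thesis using assms by (simp add: Y_odd Y_even p4)
qed

text \<open>One factor \<open>X k * X k\<close> absorbs \<open>D\<close> twice, which produces the
  squares of \<open>X (k - 2)\<close> and \<open>X (k + 2)\<close>; the other factor is multiplied
  with these by the \<open>even_square_square\<close> lemmas. The term \<open>2 * (?x * ?x)\<close>
  is removed by the constant -2 of \<open>Fd 2\<close>.\<close>

lemma Y_square_F2_even:
  assumes "even k"
  shows "Y k * Y k * Fd 2 = w (-8) *\<^sub>c (Y (k - 1) * Y (k - 1)) + w 8 *\<^sub>c (Y (k + 1) * Y (k + 1))
     + (w 4 * s1) *\<^sub>c X (k + 1) + (w (-4) * s1) *\<^sub>c X (k - 1) + (w 4 + w 2 + 2 + w (-2) + w (-4)) *\<^sub>c 1"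
proof -
  let ?x = "X k * X k"
  have o: "X (k - 1) * D = w (-2) *\<^sub>c (X (k - 2) * X (k - 2)) + w 2 *\<^sub>c ?x"
    "X (k + 1) * D = w (-2) *\<^sub>c ?x + w 2 *\<^sub>c (X (k + 2) * X (k + 2))"
    using odd_D[of "k - 1"] odd_D[of "k + 1"] assms by (simp_all add: add.commute)
  have E: "?x * D = w (-2) *\<^sub>c X (k - 1) + w 2 *\<^sub>c X (k + 1) + (w 1 + w (-1)) *\<^sub>c 1"
    by (rule even_square_D[OF assms])
  have "?x * D * D = w (-4) *\<^sub>c (X (k - 2) * X (k - 2)) + 2 * ?x + w 4 *\<^sub>c (X (k + 2) * X (k + 2)) + (w 1 + w (-1)) *\<^sub>c D"
    unfolding E distrib_right cscale_mult o
    by (simp add: cscale_distrib w_simps mult_2)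
  then have "?x * (?x * D * D) = w (-4) *\<^sub>c (?x * (X (k - 2) * X (k - 2))) + 2 * (?x * ?x)
      + w 4 *\<^sub>c (?x * (X (k + 2) * X (k + 2))) + (w 1 + w (-1)) *\<^sub>c (?x * D)"
    by (simp add: distrib_left cscale_mult mult_2)
  also have "\<dots> = w (-8) *\<^sub>c (X (k - 1) * X (k - 1)) + w 8 *\<^sub>c (X (k + 1) * X (k + 1)) + 2 * (?x * ?x)
     + (w 4 * s1) *\<^sub>c X (k + 1) + (w (-4) * s1) *\<^sub>c X (k - 1) + (w 4 + w 2 + 2 + w (-2) + w (-4)) *\<^sub>c 1"
    unfolding even_square_square_up[OF assms] even_square_square_down[OF assms] E s1_eq
    by (simp add: cscale_two cscale_distrib w_simps algebra_simps)
  finally have "?x * (?x * D * D) - 2 * (?x * ?x) = w (-8) *\<^sub>c (X (k - 1) * X (k - 1)) + w 8 *\<^sub>c (X (k + 1) * X (k + 1))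
     + (w 4 * s1) *\<^sub>c X (k + 1) + (w (-4) * s1) *\<^sub>c X (k - 1) + (w 4 + w 2 + 2 + w (-2) + w (-4)) *\<^sub>c 1"
    by simp
  moreover have "?x * ?x * Fd 2 = ?x * (?x * D * D) - 2 * (?x * ?x)"
    by (simp add: Fcheb_2 right_diff_distrib mult_2 mult_2_right mult.assoc)
  ultimately show ?thesis using assms by (simp add: Y_odd Y_even)
qed

text \<open>The inner coefficient sum of the linear terms with its factor \<open>s1\<close> divided
  out: four consecutive summands form \<open>s1\<close> times one power, as \<open>e_coef_eq\<close>
  shows.\<close>

definition e_coef :: "int \<Rightarrow> 'a center" where
  "e_coef i = (\<Sum>t\<in>{1..i}. w (8 * t - 4))"

lemma e_coef_nonpos [simp]: "i \<le> 0 \<Longrightarrow> e_coef i = 0"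
  by (simp add: e_coef_def)

lemma e_coef_step: "1 \<le> i \<Longrightarrow> e_coef i = e_coef (i - 1) + w (8 * i - 4)"
  unfolding e_coef_def by (rule sum_atLeastAtMost_int_Suc)

lemma e_coef_shift:
  assumes "1 \<le> i"
  shows "e_coef i = w 8 * e_coef (i - 1) + w 4"
  using assms
proof (induction i rule: int_ge_induct)
  case (step i)
  have "8 * (1 + i) - 4 = 8 + (8 * i - 4)" by simp
  then have "w (8 * (1 + i) - 4) = w 8 * w (8 * i - 4)" unfolding w_mult by simp
  then show ?case using e_coef_step[of "i + 1"] e_coef_step[of i] step
    by (simp add: algebra_simps)
qed (simp add: e_coef_def)

lemma e_coef_shift':
  "w (-8) * e_coef i = e_coef (i - 1) + (if 1 \<le> i then w (-4) else 0)"
  using e_coef_shift[of i] by (simp add: distrib_left w_simps)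

lemma e_coef_eq:
  assumes "0 \<le> i"
  shows "s1 * e_coef i = (\<Sum>l\<in>{1..4 * i}. w (-1 + 2 * l))"
  using assms
proof (induction i rule: int_ge_induct)
  case (step i)
  let ?f = "\<lambda>l. w (-1 + 2 * l)"
  have "sum ?f {1..4 * i + 4} = sum ?f {1..4 * i} + ?f (4 * i + 1) + ?f (4 * i + 2) + ?f (4 * i + 3) + ?f (4 * i + 4)"
    using step.hyps sum_atLeastAtMost_int_Suc[of 1 "4 * i + 1" ?f] sum_atLeastAtMost_int_Suc[of 1 "4 * i + 2" ?f]
      sum_atLeastAtMost_int_Suc[of 1 "4 * i + 3" ?f] sum_atLeastAtMost_int_Suc[of 1 "4 * i + 4" ?f]
    by (simp add: add.commute)
  moreover have "s1 * w (8 * (i + 1) - 4) = ?f (4 * i + 1) + ?f (4 * i + 2) + ?f (4 * i + 3) + ?f (4 * i + 4)"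
    unfolding s1_eq by (simp add: w_simps algebra_simps)
  moreover have "4 * (i + 1) = 4 * i + 4" by simp
  ultimately show ?case
    using e_coef_step[of "i + 1"] step by (simp add: distrib_left )
qed simp

text \<open>The linear terms that arise when \<open>Fd 2\<close> acts on the square of
  \<open>Y (m + n)\<close>, as coefficients of \<open>X (m + 2 * n + 2 - 2 * k)\<close> without the
  factor \<open>s1\<close>.\<close>

definition y_part :: "int \<Rightarrow> int \<Rightarrow> 'a center" where
  "y_part n k = (if even n then of_bool (2 * k = n + 2) * w (4 * n - 4)
     else of_bool (2 * k = n + 1) * w (4 * n) + of_bool (2 * k = n + 3) * w (4 * n - 8))"

text \<open>The comparison of linear terms in the induction for two odd variables. The minimum
  changes its branch in the middle of the range; there one summand of \<open>e_coef\<close> is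
  missing, and \<open>y_part\<close> provides it.\<close>

lemma e_coef_rec:
  assumes "1 \<le> n" "1 \<le> k" "k \<le> n + 1"
  shows "e_coef (min k (n - k)) + w (-8) * e_coef (min (k - 2) (n - (k - 2)))
      - w (-8) * e_coef (min (k - 2) (n - 1 - (k - 2))) + y_part n k - of_bool (k = n + 1) * w (-4)
    = e_coef (min k (n + 1 - k))"
proof (cases "n = 1")
  case True
  then have "k = 1 \<or> k = 2" using assms by auto
  then show ?thesis using True by (auto simp: y_part_def e_coef_def)
next
  case False
  \<comment> \<open>For \<open>n > 1\<close> the truncations in the two uses of
    \<open>e_coef_shift'\<close> differ only at \<open>k = n + 1\<close>, where the term with
    \<open>of_bool\<close> compensates.\<close>
  have bool: "(if 1 \<le> min (k - 2) (n - (k - 2)) then w (-4) else 0) =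
      (if 1 \<le> min (k - 2) (n - 1 - (k - 2)) then w (-4) else 0) + of_bool (k = n + 1) * w (-4)"
    using False assms by auto
  have m: "min (k - 2) (n - (k - 2)) - 1 = min (k - 3) (n - k + 1)"
    "min (k - 2) (n - 1 - (k - 2)) - 1 = min (k - 3) (n - k)" by auto
  have "e_coef (min k (n - k)) + e_coef (min (k - 3) (n - k + 1)) - e_coef (min (k - 3) (n - k)) + y_part n k
     = e_coef (min k (n + 1 - k))"
  proof -
    consider "2 * k \<le> n" | "n = 2 * k - 1" | "n = 2 * k - 2" | "n = 2 * k - 3" | "n \<le> 2 * k - 4"
      by linarith
    then show ?thesis
    proof cases
      case 1
      then show ?thesis by (simp add: y_part_def min_def)
    next
      case 2
      then show ?thesis using e_coef_step[of k] assms by (simp add: y_part_def min_def)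
    next
      case 3
      then show ?thesis using e_coef_step[of "k - 1"] assms False by (simp add: y_part_def min_def)
    next
      case 4
      then show ?thesis using e_coef_step[of "k - 2"] assms False by (simp add: y_part_def min_def)
    next
      case 5
      then have m: "min k (n - k) = n - k" "min (k - 3) (n - k + 1) = n + 1 - k"
        "min (k - 3) (n - k) = n - k" "min k (n + 1 - k) = n + 1 - k" by auto
      show ?thesis unfolding m using 5 by (simp add: y_part_def)
    qed
  qed
  then show ?thesis unfolding e_coef_shift' bool m by (simp add: algebra_simps)
qed

section \<open>The scalar coefficients \<open>gamma\<close>\<close>

abbreviation a' :: "int \<Rightarrow> 'a center" where "a' j \<equiv> of_int (acoef j)"
abbreviation b' :: "int \<Rightarrow> 'a center" where "b' j \<equiv> of_int (bcoef j)"

lemma w_collect: "w i * (c * w j) = w (i + j) * c"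
  by (simp add: w_mult_left mult.commute[of c])

definition gamma :: "int \<Rightarrow> 'a center" where
  "gamma k = (\<Sum>i\<in>{1..k}. a' i * (w (4 * i - 2) + w (8 * k - 4 * i + 2)))
    + (\<Sum>i\<in>{1..k - 1}. b' i * (w (4 * i) + w (8 * k - 4 * i))) + b' k * w (4 * k)"

text \<open>The exponents in \<open>gamma k\<close> are symmetric about \<open>4 * k\<close>. Below
  this center the summands do not depend on \<open>k\<close>; above it they do so only through a
  power of \<open>w\<close> once \<open>w (4 * k)\<close> is divided out. Both halves therefore have
  first-order recursions.\<close>

definition gamma_low :: "int \<Rightarrow> 'a center" where
  "gamma_low k = (\<Sum>i\<in>{1..k}. a' i * w (4 * i - 2)) + (\<Sum>i\<in>{1..k - 1}. b' i * w (4 * i))"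

definition gamma_high :: "int \<Rightarrow> 'a center" where
  "gamma_high k = (\<Sum>i\<in>{1..k}. a' i * w (4 * k - 4 * i + 2)) + (\<Sum>i\<in>{1..k - 1}. b' i * w (4 * k - 4 * i))"

lemma gamma_split: "gamma k = gamma_low k + w (4 * k) * gamma_high k + b' k * w (4 * k)"
proof -
  have "w (4 * k) * (c * w (4 * k - 4 * i + 2)) = c * w (8 * k - 4 * i + 2)"
    "w (4 * k) * (c * w (4 * k - 4 * i)) = c * w (8 * k - 4 * i)" for c i
    by (simp_all add: w_simps w_collect algebra_simps)
  then show ?thesis
    unfolding gamma_def gamma_low_def gamma_high_def distrib_left sum.distrib sum_distrib_left
    by (simp only: ac_simps)
qed

lemma gamma_low_step:
  assumes "0 \<le> k"
  shows "gamma_low (k + 1) = gamma_low k + a' (k + 1) * w (4 * k + 2) + b' k * w (4 * k)"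
proof (cases "k = 0")
  case False
  then show ?thesis
    using assms sum_atLeastAtMost_int_Suc[of 1 "k + 1" "\<lambda>i. a' i * w (4 * i - 2)"]
      sum_atLeastAtMost_int_Suc[of 1 k "\<lambda>i. b' i * w (4 * i)"]
    by (simp add: gamma_low_def algebra_simps)
qed (simp add: gamma_low_def)

lemma gamma_high_step:
  assumes "0 \<le> k"
  shows "gamma_high (k + 1) = w 4 * gamma_high k + a' (k + 1) * w 2 + b' k * w 4"
proof (cases "k = 0")
  case False
  have "w 4 * (c * w (4 * k - 4 * i + 2)) = c * w (4 * (k + 1) - 4 * i + 2)"
    "w 4 * (c * w (4 * k - 4 * i)) = c * w (4 * (k + 1) - 4 * i)" for c i
    by (simp_all add: w_simps w_collect algebra_simps)
  then have "w 4 * gamma_high k = (\<Sum>i\<in>{1..k}. a' i * w (4 * (k + 1) - 4 * i + 2))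
      + (\<Sum>i\<in>{1..k - 1}. b' i * w (4 * (k + 1) - 4 * i))"
    by (simp only: gamma_high_def distrib_left sum_distrib_left)
  moreover have "gamma_high (k + 1) = ((\<Sum>i\<in>{1..k}. a' i * w (4 * (k + 1) - 4 * i + 2)) + a' (k + 1) * w 2)
      + ((\<Sum>i\<in>{1..k - 1}. b' i * w (4 * (k + 1) - 4 * i)) + b' k * w 4)"
    using assms False sum_atLeastAtMost_int_Suc[of 1 "k + 1" "\<lambda>i. a' i * w (4 * (k + 1) - 4 * i + 2)"]
      sum_atLeastAtMost_int_Suc[of 1 k "\<lambda>i. b' i * w (4 * (k + 1) - 4 * i)"]
    by (simp add: gamma_high_def)
  ultimately show ?thesis by (simp only: ac_simps)
qed (simp add: gamma_high_def)

definition e_sum :: "int \<Rightarrow> 'a center" where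
  "e_sum n = (\<Sum>k\<in>{1..n - 1}. e_coef (min k (n - k)))"

text \<open>Raising \<open>n\<close> by 2 and \<open>k\<close> by 1 raises the minimum of
  \<open>k\<close> and \<open>n - k\<close> by 1, so \<open>e_coef_shift\<close> applies to each of
  the \<open>n + 1\<close> summands.\<close>

lemma e_sum_step:
  assumes "0 \<le> n"
  shows "e_sum (n + 2) = w 8 * e_sum n + of_int (n + 1) * w 4"
proof -
  have "e_sum (n + 2) = (\<Sum>k\<in>{1..n + 1}. w 8 * e_coef (min (k - 1) (n - (k - 1))) + w 4)"
    unfolding e_sum_def
  proof (rule sum.cong)
    fix k assume "k \<in> {1..n + 1}"
    then have "1 \<le> min k (n + 2 - k)" by simp
    moreover have "min k (n + 2 - k) - 1 = min (k - 1) (n - (k - 1))" by simp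
    ultimately show "e_coef (min k (n + 2 - k)) = w 8 * e_coef (min (k - 1) (n - (k - 1))) + w 4"
      using e_coef_shift[of "min k (n + 2 - k)"] by simp
  qed simp
  also have "\<dots> = w 8 * (\<Sum>k\<in>{1..n + 1}. e_coef (min (k - 1) (n - (k - 1)))) + of_int (n + 1) * w 4"
    using assms by (simp add: sum.distrib sum_distrib_left)
  also have "(\<Sum>k\<in>{1..n + 1}. e_coef (min (k - 1) (n - (k - 1)))) = (\<Sum>k\<in>{0..n}. e_coef (min k (n - k)))"
    by (rule sum.reindex_bij_witness[of _ "\<lambda>k. k + 1" "\<lambda>k. k - 1"]) auto
  also have "\<dots> = e_sum n"
    unfolding e_sum_def
  proof (rule sum.mono_neutral_right)
    have "e_coef (min k (n - k)) = 0" if "k \<le> 0 \<or> n \<le> k" for k using that by auto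
    then show "\<forall>k\<in>{0..n} - {1..n - 1}. e_coef (min k (n - k)) = 0" by fastforce
  qed auto
  finally show ?thesis .
qed

text \<open>The scalar left over when \<open>Fd 2\<close> acts on the square of
  \<open>Y (m + n)\<close>. As \<open>m\<close> is odd, even \<open>n\<close> belongs to an odd
  index.\<close>

definition eps :: "int \<Rightarrow> 'a center" where
  "eps n = (if even n then w 4 + w (-4) else w 4 + w 2 + 2 + w (-2) + w (-4))"

text \<open>The difference of \<open>gamma (n + 1)\<close> and \<open>gamma (n - 1)\<close> divided
  by \<open>w (4 * n)\<close>; the values of \<open>gamma_low\<close> have telescoped, so only
  \<open>gamma_high\<close> remains.\<close>

definition gamma_diff :: "int \<Rightarrow> 'a center" where
  "gamma_diff n = a' (n + 1) * w 2 + a' n * w (-2) + b' n + b' (n + 1) * w 4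
     + w 4 * gamma_high (n + 1) - w (-4) * gamma_high (n - 1)"

lemma gamma_diff:
  assumes "1 \<le> n"
  shows "gamma (n + 1) - gamma (n - 1) = w (4 * n) * gamma_diff n"
  using gamma_low_step[of n] gamma_low_step[of "n - 1"] assms
  by (simp add: gamma_split gamma_diff_def algebra_simps w_simps w_collect)

lemma s1_square: "s1 * s1 = w 6 + 2 * w 4 + 3 * w 2 + 4 + 3 * w (-2) + 2 * w (-4) + w (-6)"
  unfolding s1_eq by (simp add: algebra_simps w_simps w_collect)

text \<open>Two steps of the recursion for \<open>gamma_high\<close>, with all integer coefficients
  expressed through \<open>acoef n\<close>, \<open>bcoef n\<close> and \<open>bcoef (n - 1)\<close>,
  leave an identity between Laurent polynomials.\<close>

lemma gamma_diff_step:
  assumes "1 \<le> n"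
  shows "gamma_diff (n + 2) = w 8 * gamma_diff n + s1 * s1 * (of_int (n + 1) * w 4)"
proof -
  have a: "acoef (n + 1) = acoef n + n" "acoef (n + 2) = acoef n + 2 * n + 1" "acoef (n + 3) = acoef n + 3 * n + 3"
    using acoef_step[of n] acoef_step[of "n + 1"] acoef_step[of "n + 2"] by (simp_all add: add.commute)
  have b: "bcoef (n + 2) = bcoef n + 2 * n + 2" "bcoef (n + 1) = bcoef (n - 1) + 2 * n"
    "bcoef (n + 3) = bcoef (n - 1) + 4 * n + 4"
    using bcoef_step2[of n] bcoef_step2[of "n - 1"] bcoef_step2[of "n + 1"] by (simp_all add: add.commute)
  have h1: "gamma_high (n + 3) = w 8 * gamma_high (n + 1) + a' (n + 2) * w 6 + b' (n + 1) * w 8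
      + a' (n + 3) * w 2 + b' (n + 2) * w 4"
    using gamma_high_step[of "n + 1"] gamma_high_step[of "n + 2"] assms by (simp add: algebra_simps w_simps w_collect)
  have h2: "gamma_high (n + 1) = w 8 * gamma_high (n - 1) + a' n * w 6 + b' (n - 1) * w 8
      + a' (n + 1) * w 2 + b' n * w 4"
    using gamma_high_step[of "n - 1"] gamma_high_step[of n] assms by (simp add: algebra_simps w_simps w_collect)
  have "gamma_diff (n + 2) = a' (n + 3) * w 2 + a' (n + 2) * w (-2) + b' (n + 2) + b' (n + 3) * w 4
     + w 4 * gamma_high (n + 3) - w (-4) * gamma_high (n + 1)"
    by (simp add: gamma_diff_def add.commute)
  then show ?thesis
    unfolding h1 h2 gamma_diff_def[of n] s1_square a b of_int_add of_int_mult of_int_numeral of_int_1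
    by (simp add: algebra_simps w_simps w_collect)
qed

text \<open>Both sides satisfy the recursion of step 2 in \<open>gamma_diff_step\<close>: the first
  summand by \<open>e_sum_step\<close>, while \<open>w (4 * n) * eps n\<close> is multiplied by
  \<open>w 8\<close> because \<open>eps\<close> depends only on parity. It remains to check
  \<open>n = 1\<close> and \<open>n = 2\<close>.\<close>

lemma gamma_diff_eq:
  assumes "1 \<le> n"
  shows "gamma_diff n = s1 * s1 * e_sum n + w (4 * n) * eps n"
proof -
  have "gamma_diff (r + 1) = s1 * s1 * e_sum (r + 1) + w (4 * (r + 1)) * eps (r + 1)" if "0 \<le> r" for r
    using that
  proof (induction r rule: int_two_step_induct)
    case zero
    have "acoef 2 = 1" "bcoef 2 = 2" using acoef_step[of 1] bcoef_step2[of 0] by simp_all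
    moreover have "gamma_high 0 = 0" by (simp add: gamma_high_def)
    ultimately show ?case
      using gamma_high_step[of 0] gamma_high_step[of 1]
      by (simp add: gamma_diff_def e_sum_def eps_def algebra_simps w_simps w_collect)
  next
    case one
    have "acoef 2 = 1" "bcoef 2 = 2" "acoef 3 = 3" "bcoef 3 = 5"
      using acoef_step[of 1] bcoef_step2[of 0] acoef_step[of 2] bcoef_step2[of 1] by simp_all
    moreover have "gamma_high 0 = 0" by (simp add: gamma_high_def)
    moreover have "e_coef 1 = w 4" by (simp add: e_coef_def)
    ultimately show ?case
      using gamma_high_step[of 0] gamma_high_step[of 1] gamma_high_step[of 2]
      by (simp add: gamma_diff_def e_sum_def eps_def s1_square algebra_simps w_simps w_collect)
  next
    case (step r)
    have "gamma_diff (r + 2) = w 8 * (s1 * s1 * e_sum r + w (4 * r) * eps r) + s1 * s1 * (of_int (r + 1) * w 4)"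
      using gamma_diff_step[OF step.hyps] step.IH(1) by simp
    also have "\<dots> = s1 * s1 * (w 8 * e_sum r + of_int (r + 1) * w 4) + w (4 * (r + 2)) * eps (r + 2)"
      by (simp add: eps_def algebra_simps w_simps w_collect)
    finally show ?case using e_sum_step[of r] step.hyps by (simp add: add.commute)
  qed
  from this[of "n - 1"] show ?thesis using assms by simp
qed

section \<open>Products of two odd cluster variables: the induction\<close>

lemma Y_square_F2:
  assumes "odd m"
  shows "(w (-4) * w (4 * n)) *\<^sub>c (Y (m + n) * Y (m + n) * Fd 2) =
     w (4 * (n - 1) - 8) *\<^sub>c (Y (m + (n - 1)) * Y (m + (n - 1))) + w (4 * (n + 1)) *\<^sub>c (Y (m + (n + 1)) * Y (m + (n + 1)))
   + (if even n then (s1 * w (4 * n - 4)) *\<^sub>c X (m + n)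
      else (s1 * w (4 * n)) *\<^sub>c X (m + n + 1) + (s1 * w (4 * n - 8)) *\<^sub>c X (m + n - 1))
   + (w (4 * n - 4) * eps n) *\<^sub>c 1"
proof (cases "even n")
  case True
  then show ?thesis using Y_square_F2_odd[of "m + n"] assms
    by (simp add: eps_def cscale_distrib w_simps algebra_simps)
next
  case False
  then show ?thesis using Y_square_F2_even[of "m + n"] assms
    by (simp add: eps_def cscale_distrib w_simps algebra_simps)
qed

lemma y_part_sum:
  assumes "1 \<le> n"
  shows "(\<Sum>k\<in>{1..n + 1}. (s1 * y_part n k) *\<^sub>c X (m + 2 * n + 2 - 2 * k)) =
    (if even n then (s1 * w (4 * n - 4)) *\<^sub>c X (m + n)
      else (s1 * w (4 * n)) *\<^sub>c X (m + n + 1) + (s1 * w (4 * n - 8)) *\<^sub>c X (m + n - 1))"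
proof (cases "even n")
  case True
  then obtain r where r: "n = 2 * r" by (elim evenE)
  have "(s1 * y_part n k) *\<^sub>c X (m + 2 * n + 2 - 2 * k) =
      (if k = r + 1 then (s1 * w (4 * n - 4)) *\<^sub>c X (m + n) else 0)" for k
    using r by (auto simp: y_part_def add.commute)
  then show ?thesis using assms r by (simp add: sum.delta)
next
  case False
  then obtain r where r: "n = 2 * r + 1" by (elim oddE)
  have "(s1 * y_part n k) *\<^sub>c X (m + 2 * n + 2 - 2 * k) =
      (if k = r + 1 then (s1 * w (4 * n)) *\<^sub>c X (m + n + 1) else 0)
      + (if k = r + 2 then (s1 * w (4 * n - 8)) *\<^sub>c X (m + n - 1) else 0)" for k
    using r by (auto simp: y_part_def algebra_simps)
  then show ?thesis using assms r by (simp add: sum.distrib sum.delta)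
qed

lemma e_sum_extend:
  assumes "n - 1 \<le> N"
  shows "(\<Sum>k\<in>{1..N}. (s1 * e_coef (min k (n - k))) *\<^sub>c f k) =
    (\<Sum>k\<in>{1..n - 1}. (s1 * e_coef (min k (n - k))) *\<^sub>c f k)"
  by (rule sum.mono_neutral_right) (use assms in auto)

text \<open>The two neighbours produced by \<open>Fd 2\<close> are two summation steps apart. The
  end terms vanish because the argument of \<open>e_coef\<close> is nonpositive there.\<close>

lemma e_sum_shift:
  assumes "n \<le> N - 1"
  shows "(\<Sum>k\<in>{1..N}. (s1 * e_coef (min k (n - k))) *\<^sub>c X (i - 2 - 2 * k)) =
    (\<Sum>k\<in>{1..N}. (s1 * e_coef (min (k - 2) (n - (k - 2)))) *\<^sub>c X (i + 2 - 2 * k))"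
proof -
  let ?g = "\<lambda>k. (s1 * e_coef (min (k - 2) (n - (k - 2)))) *\<^sub>c X (i + 2 - 2 * k)"
  have "(\<Sum>k\<in>{1..N}. (s1 * e_coef (min k (n - k))) *\<^sub>c X (i - 2 - 2 * k)) = sum ?g {3..N + 2}"
    by (rule sum.reindex_bij_witness[of _ "\<lambda>k. k - 2" "\<lambda>k. k + 2"]) (auto simp: algebra_simps)
  also have "\<dots> = sum ?g {1..N + 2}"
    by (rule sum.mono_neutral_left) auto
  also have "\<dots> = sum ?g {1..N}"
    by (rule sum.mono_neutral_right) (use assms in auto)
  finally show ?thesis .
qed

lemma mult_odd_rec:
  assumes "odd k"
  shows "Z * X (k + 2) = w (-4) *\<^sub>c (Z * X k * Fd 2) - w (-8) *\<^sub>c (Z * X (k - 2)) - (w (-4) * s1) *\<^sub>c Z"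
  by (simp add: odd_F2[OF assms] mult.assoc cscale_expand w_simps)

text \<open>The recursion \<open>mult_odd_rec\<close> is checked separately on squares of
  \<open>Y\<close>, linear terms, Chebyshev sums and scalars. The squares pass on linear terms and a
  scalar, the linear terms pass on a scalar through \<open>s1\<close>; these are absorbed by
  \<open>e_coef_rec\<close> and \<open>gamma_diff_eq\<close>.\<close>

lemma odd_odd_aux:
  assumes "odd m" "0 \<le> n"
  shows "X m * X (m + 2 * n) = w (4 * n) *\<^sub>c (Y (m + n) * Y (m + n))
    + (\<Sum>k\<in>{1..n - 1}. (s1 * e_coef (min k (n - k))) *\<^sub>c X (m + 2 * n - 2 * k))
    + w (- 4 * n) *\<^sub>c (\<Sum>k\<in>{1..n}. gamma k *\<^sub>c Fd (2 * n - 2 * k))"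
  using assms(2)
proof (induction n rule: int_two_step_induct)
  case zero
  show ?case using assms(1) by (simp add: Y_odd)
next
  case one
  have "gamma 1 = w 4" by (simp add: gamma_def)
  moreover have "X (m + 1) ^ 4 = X (m + 1) * X (m + 1) * (X (m + 1) * X (m + 1))"
    by (simp add: numeral_eq_Suc mult.assoc)
  ultimately show ?case using exchange_even[of "m + 1"] assms(1)
    by (simp add: Y_even w_simps add.commute)
next
  case (step n)
  let ?A = "{1..n + 1}"
  let ?S = "\<lambda>b. \<Sum>k\<in>?A. (s1 * e_coef (min k (b - k))) *\<^sub>c X (m + 2 * b - 2 * k)"
  let ?G = "\<lambda>b. \<Sum>k\<in>?A. gamma k *\<^sub>c Fd (2 * b - 2 * k)"
  let ?Z = "\<lambda>b. Y (m + b) * Y (m + b)"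
  let ?y = "if even n then (s1 * w (4 * n - 4)) *\<^sub>c X (m + n)
      else (s1 * w (4 * n)) *\<^sub>c X (m + n + 1) + (s1 * w (4 * n - 8)) *\<^sub>c X (m + n - 1)"
  have IH1: "X m * X (m + 2 * n) = w (4 * n) *\<^sub>c ?Z n + ?S n + w (- 4 * n) *\<^sub>c ?G n"
    using step.IH(2) e_sum_extend[of n "n + 1"] cheb_sum_extend[of "2 * n" n "n + 1" gamma D] by simp
  have IH2: "X m * X (m + 2 * (n - 1)) = w (4 * (n - 1)) *\<^sub>c ?Z (n - 1) + ?S (n - 1) + w (- 4 * (n - 1)) *\<^sub>c ?G (n - 1)"
    using step.IH(1) e_sum_extend[of "n - 1" "n + 1"] cheb_sum_extend[of "2 * (n - 1)" "n - 1" "n + 1" gamma D] by simp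
  have G0: "gamma 0 = 0" by (simp add: gamma_def)
  have G: "?G n * Fd 2 = ?G (n + 1) + ?G (n - 1) + (gamma (n - 1) - gamma (n + 1)) *\<^sub>c 1"
    using cheb_sum_mult_F2[of gamma n "n + 1" D] G0 step.hyps by (simp add: algebra_simps)

  have e: "m + 2 * n - 2 * k - 2 = m + 2 * n - 2 - 2 * k" "m + 2 * n - 2 * k + 2 = m + 2 * n + 2 - 2 * k"
     "m + 2 * (n - 1) - 2 * k = m + 2 * n - 2 - 2 * k" "m + 2 * (n + 1) - 2 * k = m + 2 * n + 2 - 2 * k" for k
    by simp_all
  have shift: "(\<Sum>k\<in>?A. (s1 * e_coef (min k (n - k))) *\<^sub>c X (m + 2 * n - 2 - 2 * k)) =
        (\<Sum>k\<in>?A. (s1 * e_coef (min (k - 2) (n - (k - 2)))) *\<^sub>c X (m + 2 * n + 2 - 2 * k))"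
      "(\<Sum>k\<in>?A. (s1 * e_coef (min k (n - 1 - k))) *\<^sub>c X (m + 2 * n - 2 - 2 * k)) =
        (\<Sum>k\<in>?A. (s1 * e_coef (min (k - 2) (n - 1 - (k - 2)))) *\<^sub>c X (m + 2 * n + 2 - 2 * k))"
    by (rule e_sum_shift; simp)+
  have "w (-4) *\<^sub>c ((s1 * c) *\<^sub>c X (m + 2 * n - 2 * k) * Fd 2) = (s1 * c) *\<^sub>c X (m + 2 * n + 2 - 2 * k)
      + w (-8) *\<^sub>c ((s1 * c) *\<^sub>c X (m + 2 * n - 2 - 2 * k)) + (w (-4) * (s1 * s1 * c)) *\<^sub>c 1" for c k
  proof -
    have "X (m + 2 * n - 2 * k) * Fd 2 = w (-4) *\<^sub>c X (m + 2 * n - 2 - 2 * k) + w 4 *\<^sub>c X (m + 2 * n + 2 - 2 * k) + s1 *\<^sub>c 1"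
      using odd_F2[of "m + 2 * n - 2 * k", unfolded e] assms(1) by simp
    then show ?thesis
      by (simp add: cscale_mult cscale_distrib mult.commute[of "s1 * c"] w_simps ac_simps)
  qed
  then have SD: "w (-4) *\<^sub>c (?S n * Fd 2) = (\<Sum>k\<in>?A. (s1 * e_coef (min k (n - k))) *\<^sub>c X (m + 2 * n + 2 - 2 * k))
      + w (-8) *\<^sub>c (\<Sum>k\<in>?A. (s1 * e_coef (min k (n - k))) *\<^sub>c X (m + 2 * n - 2 - 2 * k))
      + (w (-4) * (s1 * s1 * (\<Sum>k\<in>?A. e_coef (min k (n - k))))) *\<^sub>c 1"
    by (simp only: sum_distrib_right cscale_sum_right sum.distrib sum_distrib_left cscale_sum_left)
  \<comment> \<open>The additional term of \<open>mult_odd_rec\<close> is a multiple of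
    \<open>X m\<close>, which is the linear term with index \<open>k = n + 1\<close>.\<close>
  have last: "(w (-4) * s1) *\<^sub>c X m = (\<Sum>k\<in>?A. (s1 * (of_bool (k = n + 1) * w (-4))) *\<^sub>c X (m + 2 * n + 2 - 2 * k))"
  proof -
    have "(s1 * (of_bool (k = n + 1) * w (-4))) *\<^sub>c X (m + 2 * n + 2 - 2 * k)
      = (if k = n + 1 then (w (-4) * s1) *\<^sub>c X m else 0)" for k
      by (auto simp: ac_simps)
    then show ?thesis using step.hyps by (simp add: sum.delta)
  qed
  have esum: "(\<Sum>k\<in>?A. e_coef (min k (n - k))) = e_sum n"
    unfolding e_sum_def by (rule sum.mono_neutral_right) auto

  have "w (-4) *\<^sub>c (?S n * Fd 2) - w (-8) *\<^sub>c ?S (n - 1) + ?y - (w (-4) * s1) *\<^sub>c X m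
     = (\<Sum>k\<in>?A. (s1 * (e_coef (min k (n - k)) + w (-8) * e_coef (min (k - 2) (n - (k - 2)))
      - w (-8) * e_coef (min (k - 2) (n - 1 - (k - 2))) + y_part n k - of_bool (k = n + 1) * w (-4)))
        *\<^sub>c X (m + 2 * n + 2 - 2 * k)) + (w (-4) * (s1 * s1 * e_sum n)) *\<^sub>c 1"
    unfolding SD e shift last y_part_sum[OF step.hyps, symmetric] esum
    by (simp add: cscale_distrib cscale_sum_right sum.distrib sum_subtractf distrib_left right_diff_distrib
        mult.left_commute[of s1])
  also have "\<dots> = ?S (n + 1) + (w (-4) * (s1 * s1 * e_sum n)) *\<^sub>c 1"
    unfolding e using e_coef_rec[OF step.hyps] by simp
  finally have S: "w (-4) *\<^sub>c (?S n * Fd 2) - w (-8) *\<^sub>c ?S (n - 1) + ?y - (w (-4) * s1) *\<^sub>c X m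
     = ?S (n + 1) + (w (-4) * (s1 * s1 * e_sum n)) *\<^sub>c 1" .

  \<comment> \<open>All scalars of the step are collected here: the correction from
    \<open>cheb_sum_mult_F2\<close>, the contribution of the linear terms and that of the
    square.\<close>
  have "w (-4 * n - 4) * (gamma (n + 1) - gamma (n - 1)) = w (-4) * (s1 * s1 * e_sum n) + w (4 * n - 4) * eps n"
    unfolding gamma_diff[OF step.hyps] gamma_diff_eq[OF step.hyps] by (simp add: distrib_left w_simps)
  then have "w (-4 * n - 4) * (gamma (n - 1) - gamma (n + 1)) + w (-4) * (s1 * s1 * e_sum n) + w (4 * n - 4) * eps n = 0"
    by (simp add: right_diff_distrib eq_diff_eq diff_eq_eq add.assoc)
  then have "(w (-4 * n - 4) * (gamma (n - 1) - gamma (n + 1)) + w (-4) * (s1 * s1 * e_sum n) + w (4 * n - 4) * eps n) *\<^sub>c (1::'a) = 0"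
    by simp
  then have gam: "w (-4 * n - 4) *\<^sub>c ((gamma (n - 1) - gamma (n + 1)) *\<^sub>c (1::'a))
      + (w (-4) * (s1 * s1 * e_sum n)) *\<^sub>c 1 + (w (4 * n - 4) * eps n) *\<^sub>c 1 = 0"
    by (simp only: cscale_distrib(1) cscale_simps(6))
  have rearrange: "a + b + (s + c) + (d + e) = a + s + b + (d + c + e)" for a b c d e s :: 'a
    by (simp only: ac_simps)

  have x: "w (-4) * w (-4 * n) = w (-4 * n - 4)" "w (-8) * w (-4 * (n - 1)) = w (-4 * n - 4)"
    "w (-8) * w (4 * (n - 1)) = w (4 * (n - 1) - 8)"
    unfolding w_mult by (rule arg_cong[of _ _ w]; simp)+
  have i: "m + 2 * n + 2 = m + 2 * (n + 1)" "m + 2 * n - 2 = m + 2 * (n - 1)" by simp_all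
  have "X m * X (m + 2 * (n + 1)) = w (-4) *\<^sub>c (X m * X (m + 2 * n) * Fd 2)
      - w (-8) *\<^sub>c (X m * X (m + 2 * (n - 1))) - (w (-4) * s1) *\<^sub>c X m"
    by (rule mult_odd_rec[of "m + 2 * n" "X m", unfolded i]) (use assms(1) in simp)
  also have "\<dots> = (w (-4) * w (4 * n)) *\<^sub>c (?Z n * Fd 2) + w (-4) *\<^sub>c (?S n * Fd 2) + w (-4 * n - 4) *\<^sub>c (?G n * Fd 2)
     - (w (4 * (n - 1) - 8) *\<^sub>c ?Z (n - 1) + w (-8) *\<^sub>c ?S (n - 1) + w (-4 * n - 4) *\<^sub>c ?G (n - 1)) - (w (-4) * s1) *\<^sub>c X m"
    unfolding IH1 IH2 distrib_right cscale_distrib cscale_mult cscale_simps x ..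
  also have "\<dots> = w (4 * (n + 1)) *\<^sub>c ?Z (n + 1) + w (-4 * n - 4) *\<^sub>c ?G (n + 1)
     + (w (-4) *\<^sub>c (?S n * Fd 2) - w (-8) *\<^sub>c ?S (n - 1) + ?y - (w (-4) * s1) *\<^sub>c X m)
     + (w (-4 * n - 4) *\<^sub>c ((gamma (n - 1) - gamma (n + 1)) *\<^sub>c 1) + (w (4 * n - 4) * eps n) *\<^sub>c 1)"
    unfolding Y_square_F2[OF assms(1)] G cscale_distrib(2)[of "w (-4 * n - 4)"] by simp
  also have "\<dots> = w (4 * (n + 1)) *\<^sub>c ?Z (n + 1) + ?S (n + 1) + w (-4 * n - 4) *\<^sub>c ?G (n + 1)"
    unfolding S rearrange gam by simp
  finally have fin: "X m * X (m + 2 * (n + 1)) = w (4 * (n + 1)) *\<^sub>c ?Z (n + 1) + ?S (n + 1) + w (-4 * n - 4) *\<^sub>c ?G (n + 1)" .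
  have "?S (n + 1) = (\<Sum>k\<in>{1..n + 1 - 1}. (s1 * e_coef (min k (n + 1 - k))) *\<^sub>c X (m + 2 * (n + 1) - 2 * k))"
    by (rule e_sum_extend) simp
  moreover have "- 4 * (n + 1) = -4 * n - 4" by simp
  ultimately show ?case using fin by (simp only:)
qed

lemma odd_odd:
  assumes "odd m" "0 \<le> n"
  shows "X m * X (m + 2 * n) = w (4 * n) *\<^sub>c (Y (m + n) * Y (m + n))
    + (\<Sum>k\<in>{1..n - 1}. (\<Sum>l\<in>{1..4 * min k (n - k)}. w (-1 + 2 * l)) *\<^sub>c X (m + 2 * n - 2 * k))
    + (\<Sum>k\<in>{1..n}. (w (-4 * n) * gamma k) *\<^sub>c Fd (2 * n - 2 * k))"
proof -
  have "(\<Sum>k\<in>{1..n - 1}. (\<Sum>l\<in>{1..4 * min k (n - k)}. w (-1 + 2 * l)) *\<^sub>c X (m + 2 * n - 2 * k))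
    = (\<Sum>k\<in>{1..n - 1}. (s1 * e_coef (min k (n - k))) *\<^sub>c X (m + 2 * n - 2 * k))"
    by (rule sum.cong) (simp_all only: e_coef_eq[symmetric] atLeastAtMost_iff, simp add: e_coef_eq)
  then show ?thesis using odd_odd_aux[OF assms] by (simp add: cscale_sum_right)
qed

end

section \<open>From the initial cluster to all indices\<close>

text \<open>The exchange relations enter in one order only, and the other data concern the initial
  cluster. The axiom \<open>seed_D\<close> is the relation for the square of \<open>X 2\<close>,
  multiplied by \<open>X 1\<close> from the left so that \<open>X 3\<close> disappears and both
  sides can be computed in the torus.\<close>

locale cluster_seed =
  fixes w :: "int \<Rightarrow> 'a::ring_1 center" and X :: "int \<Rightarrow> 'a" and D :: 'a
  assumes no_zero_divisors: "x * y = 0 \<Longrightarrow> x = (0::'a) \<or> y = 0"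
    and w_mult: "w i * w j = w (i + j)"
    and w_0 [simp]: "w 0 = 1"
    and w_neq_1: "j \<noteq> 0 \<Longrightarrow> w j \<noteq> 1"
    and seed_nonzero: "X 1 \<noteq> 0" "X 2 \<noteq> 0"
    and seed_comm: "X 1 * X 2 = w 2 *\<^sub>c (X 2 * X 1)"
    and seed_D: "X 1 * (X 2 * X 2 * D) =
      w (-2) *\<^sub>c (X 1 * X 1) + w 2 *\<^sub>c (w 4 *\<^sub>c X 2 ^ 4 + 1) + (w 1 + w (-1)) *\<^sub>c X 1"
    and seed_exchange_odd: "odd k \<Longrightarrow> X (k - 1) * X (k + 1) = w 1 *\<^sub>c X k + 1"
    and seed_exchange_even: "even k \<Longrightarrow> X (k - 1) * X (k + 1) = w 4 *\<^sub>c X k ^ 4 + 1"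
begin

lemma w_mult_left: "w i * (w j * c) = w (i + j) * c"
  by (simp add: w_mult flip: mult.assoc)

lemmas w_simps = w_mult w_mult_left

lemma cancel_left: "x \<noteq> 0 \<Longrightarrow> x * y = x * z \<Longrightarrow> y = (z::'a)"
  using no_zero_divisors[of x "y - z"] by (simp add: right_diff_distrib)

lemma cancel_right: "x \<noteq> 0 \<Longrightarrow> y * x = z * x \<Longrightarrow> y = (z::'a)"
  using no_zero_divisors[of "y - z" x] by (simp add: left_diff_distrib)

lemma w_scale_eq_self:
  assumes "w j *\<^sub>c x = x" "j \<noteq> 0"
  shows "x = 0"
proof -
  have "(w j - 1) *\<^sub>c x = 0" using assms by (simp add: cscale_distrib)
  moreover have "of_center (w j - 1) \<noteq> 0"
    using w_neq_1[OF assms(2)] by (metis eq_iff_diff_eq_0 of_center_inject zero_center.rep_eq)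
  ultimately show ?thesis using no_zero_divisors unfolding cscale_def by blast
qed

definition deg :: "int \<Rightarrow> nat" where
  "deg k = (if odd k then 1 else 4)"

lemma exchange: "X (k - 1) * X (k + 1) = w (int (deg k)) *\<^sub>c X k ^ deg k + 1"
  by (simp add: deg_def seed_exchange_odd seed_exchange_even)

lemma comm_power_right:
  assumes "x * y = w 2 *\<^sub>c (y * x)"
  shows "x * y ^ n = w (2 * int n) *\<^sub>c (y ^ n * x)"
proof (induction n)
  case (Suc n)
  have "x * y ^ Suc n = x * y ^ n * y" by (simp add: power_Suc2 mult.assoc del: power_Suc)
  also have "\<dots> = w (2 * int n) *\<^sub>c (y ^ n * (x * y))" by (simp add: Suc cscale_mult mult.assoc)
  also have "\<dots> = w (2 * int (Suc n)) *\<^sub>c (y ^ Suc n * x)"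
    by (simp add: assms cscale_mult w_simps power_Suc2 mult.assoc algebra_simps del: power_Suc)
  finally show ?case .
qed simp

lemma comm_power_left:
  assumes "x * y = w 2 *\<^sub>c (y * x)"
  shows "x ^ n * y = w (2 * int n) *\<^sub>c (y * x ^ n)"
proof (induction n)
  case (Suc n)
  have "x ^ Suc n * y = x * (x ^ n * y)" by (simp add: mult.assoc)
  also have "\<dots> = w (2 * int n) *\<^sub>c (x * y * x ^ n)" by (simp add: Suc cscale_mult mult.assoc)
  also have "\<dots> = w (2 * int (Suc n)) *\<^sub>c (y * x ^ Suc n)"
    by (simp add: assms cscale_mult w_simps mult.assoc algebra_simps)
  finally show ?case .
qed simp

definition good :: "int \<Rightarrow> bool" where
  "good k \<longleftrightarrow> X k \<noteq> 0 \<and> X (k + 1) \<noteq> 0 \<and> X k * X (k + 1) = w 2 *\<^sub>c (X (k + 1) * X k)"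

text \<open>If the new variable were 0, a scalar multiple of a power of \<open>X (k + 1)\<close>
  would be -1, hence central; moving \<open>X k\<close> past it would then give
  \<open>w j = 1\<close> for some nonzero \<open>j\<close>. For the commutation rule,
  \<open>X k * X (k + 2)\<close> is a polynomial in \<open>X (k + 1)\<close> and commutes with it;
  then \<open>X k\<close> is cancelled.\<close>

lemma good_up:
  assumes "good k"
  shows "good (k + 1)"
proof -
  let ?x = "X k" and ?y = "X (k + 1)" and ?z = "X (k + 2)"
  define d where "d = deg (k + 1)"
  have d: "d \<noteq> 0" by (simp add: d_def deg_def)
  have two: "k + 1 + 1 = k + 2" by simp
  then have ex: "?x * ?z = w (int d) *\<^sub>c ?y ^ d + 1"
    using exchange[of "k + 1"] by (simp add: d_def add.commute)
  have nz: "?x \<noteq> 0" "?y \<noteq> 0" and comm: "?x * ?y = w 2 *\<^sub>c (?y * ?x)"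
    using assms by (simp_all add: good_def)
  have "?z \<noteq> 0"
  proof
    assume "?z = 0"
    then have P: "w (int d) *\<^sub>c ?y ^ d = -1" using ex by (simp add: eq_neg_iff_add_eq_0)
    have "w (2 * int d) *\<^sub>c (w (int d) *\<^sub>c ?y ^ d * ?x) = ?x * w (int d) *\<^sub>c ?y ^ d"
      by (simp add: cscale_mult comm_power_right[OF comm] mult.commute)
    then have "w (2 * int d) *\<^sub>c ?x = ?x" unfolding P by simp
    then show False using w_scale_eq_self nz d by fastforce
  qed
  moreover have "?x * (?y * ?z) = ?x * w 2 *\<^sub>c (?z * ?y)"
  proof -
    have "?x * (?y * ?z) = w 2 *\<^sub>c (?y * (?x * ?z))"
      using comm by (simp add: cscale_mult flip: mult.assoc)
    also have "?y * (?x * ?z) = ?x * ?z * ?y"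
      unfolding ex by (simp add: cscale_mult distrib_left distrib_right power_commutes)
    finally show ?thesis by (simp add: cscale_mult mult.assoc)
  qed
  then have "?y * ?z = w 2 *\<^sub>c (?z * ?y)" using cancel_left nz by blast
  ultimately show ?thesis unfolding good_def two using nz by simp
qed

lemma good_down:
  assumes "good k"
  shows "good (k - 1)"
proof -
  let ?x = "X (k - 1)" and ?y = "X k" and ?z = "X (k + 1)"
  define d where "d = deg k"
  have d: "d \<noteq> 0" by (simp add: d_def deg_def)
  have ex: "?x * ?z = w (int d) *\<^sub>c ?y ^ d + 1"
    using exchange[of k] by (simp add: d_def)
  have nz: "?y \<noteq> 0" "?z \<noteq> 0" and comm: "?y * ?z = w 2 *\<^sub>c (?z * ?y)"
    using assms by (simp_all add: good_def)
  have "?x \<noteq> 0"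
  proof
    assume "?x = 0"
    then have P: "w (int d) *\<^sub>c ?y ^ d = -1" using ex by (simp add: eq_neg_iff_add_eq_0)
    have "w (2 * int d) *\<^sub>c (?z * w (int d) *\<^sub>c ?y ^ d) = w (int d) *\<^sub>c ?y ^ d * ?z"
      by (simp add: cscale_mult comm_power_left[OF comm] mult.commute)
    then have "w (2 * int d) *\<^sub>c ?z = ?z" unfolding P by simp
    then show False using w_scale_eq_self nz d by fastforce
  qed
  moreover have "?x * ?y * ?z = w 2 *\<^sub>c (?y * ?x) * ?z"
  proof -
    have "?x * ?y * ?z = w 2 *\<^sub>c (?x * ?z * ?y)"
      using comm by (simp add: cscale_mult mult.assoc)
    also have "?x * ?z * ?y = ?y * (?x * ?z)"
      unfolding ex by (simp add: cscale_mult distrib_left distrib_right power_commutes)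
    finally show ?thesis by (simp add: cscale_mult mult.assoc)
  qed
  then have "?x * ?y = w 2 *\<^sub>c (?y * ?x)" using cancel_right nz by blast
  ultimately show ?thesis using nz by (simp add: good_def)
qed

lemma good: "good k"
  by (induction k rule: int_induct[of _ 1])
     (use good_up good_down seed_nonzero seed_comm in \<open>simp_all add: good_def[of 1]\<close>)

lemma X_cancel: "X k * y = X k * z \<Longrightarrow> y = z"
  using cancel_left good[of k] unfolding good_def by blast

text \<open>After multiplication by \<open>X (k - 1)\<close> from the left the known order of the
  factors appears. Moving \<open>X (k - 1)\<close> back to the front past the power of
  \<open>X k\<close> costs twice the degree, which changes the sign of the exponent.\<close>

lemma exchange_reverse: "X (k + 1) * X (k - 1) = w (- int (deg k)) *\<^sub>c X k ^ deg k + 1"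
proof (rule X_cancel)
  let ?d = "deg k"
  have comm: "X (k - 1) * X k = w 2 *\<^sub>c (X k * X (k - 1))"
    using good[of "k - 1"] by (simp add: good_def)
  have "X (k - 1) * (X (k + 1) * X (k - 1)) = X (k - 1) * X (k + 1) * X (k - 1)"
    by (simp add: mult.assoc)
  also have "\<dots> = w (int ?d) *\<^sub>c (X k ^ ?d * X (k - 1)) + X (k - 1)"
    unfolding exchange by (simp add: cscale_mult distrib_right)
  also have "\<dots> = X (k - 1) * (w (- int ?d) *\<^sub>c X k ^ ?d + 1)"
    by (simp add: cscale_mult distrib_left comm_power_right[OF comm] w_simps)
  finally show "X (k - 1) * (X (k + 1) * X (k - 1)) = X (k - 1) * (w (- int ?d) *\<^sub>c X k ^ ?d + 1)" .
qed

sublocale cluster_exchange w X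
proof
  fix k
  show "X k * X (k + 1) = w 2 *\<^sub>c (X (k + 1) * X k)"
    using good[of k] by (simp add: good_def)
  show "X (k + 1) * X (k - 1) = w (-1) *\<^sub>c X k + 1" if "odd k"
    using exchange_reverse[of k] that by (simp add: deg_def)
  show "X (k + 1) * X (k - 1) = w (-4) *\<^sub>c X k ^ 4 + 1" if "even k"
    using exchange_reverse[of k] that by (simp add: deg_def)
qed (simp_all add: w_mult seed_exchange_odd seed_exchange_even)

definition D_rel :: "int \<Rightarrow> bool" where
  "D_rel k \<longleftrightarrow> (if even k
     then X k * X k * D = w (-2) *\<^sub>c X (k - 1) + w 2 *\<^sub>c X (k + 1) + (w 1 + w (-1)) *\<^sub>c 1
     else X k * D = w (-2) *\<^sub>c (X (k - 1) * X (k - 1)) + w 2 *\<^sub>c (X (k + 1) * X (k + 1)))"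

lemma D_rel_up:
  assumes "D_rel k"
  shows "D_rel (k + 1)"
  using assms even_to_odd_D[where k = k and D = D, OF X_cancel] odd_to_even_D[where k = k and D = D, OF X_cancel]
  by (cases "even k") (simp_all add: D_rel_def add.commute)

lemma D_rel_down:
  assumes "D_rel k"
  shows "D_rel (k - 1)"
proof -
  interpret R: cluster_exchange "\<lambda>j. w (- j)" "\<lambda>k. X (- k)"
    by (rule reflect_exchange)
  have e: "- (- k - 1) = k + 1" "- (- k + 1) = k - 1" "- (- k + 2) = k - 2" "- (- k) = k"
    "- (- (2::int)) = 2" "- (- (1::int)) = 1" by simp_all
  have X_cancel': "X (- k) * y = X (- k) * z \<Longrightarrow> y = z" for k y z
    by (rule X_cancel)
  have "k - 1 - 1 = k - 2" by simp
  then show ?thesis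
    using assms R.even_to_odd_D[where k = "- k" and D = D, OF X_cancel', unfolded e]
      R.odd_to_even_D[where k = "- k" and D = D, OF X_cancel', unfolded e]
    by (cases "even k") (simp_all add: D_rel_def add.commute)
qed

text \<open>The induction starts at 2, where \<open>seed_D\<close> with \<open>X 1 * X 3\<close>
  inserted allows \<open>X 1\<close> to be cancelled.\<close>

lemma D_rel: "D_rel k"
proof (induction k rule: int_induct[of _ 2])
  case base
  have ex: "X 1 * X 3 = w 4 *\<^sub>c X 2 ^ 4 + 1"
    using seed_exchange_even[of 2] by simp
  have "X 1 * (X 2 * X 2 * D) = X 1 * (w (-2) *\<^sub>c X 1 + w 2 *\<^sub>c X 3 + (w 1 + w (-1)) *\<^sub>c 1)"
    unfolding seed_D ex[symmetric] by (simp add: cscale_mult distrib_left)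
  then have "X 2 * X 2 * D = w (-2) *\<^sub>c X 1 + w 2 *\<^sub>c X 3 + (w 1 + w (-1)) *\<^sub>c 1"
    by (rule X_cancel)
  then show ?case by (simp add: D_rel_def)
qed (rule D_rel_up D_rel_down; assumption)+

sublocale cluster_relations w X D
proof
  fix k
  show E: "X k * X k * D = w (-2) *\<^sub>c X (k - 1) + w 2 *\<^sub>c X (k + 1) + (w 1 + w (-1)) *\<^sub>c 1" if "even k"
    using D_rel[of k] that by (simp add: D_rel_def)
  show "X k * D = w (-2) *\<^sub>c (X (k - 1) * X (k - 1)) + w 2 *\<^sub>c (X (k + 1) * X (k + 1))" if "odd k"
    using D_rel[of k] that by (simp add: D_rel_def)
  \<comment> \<open>For even \<open>k\<close> the relation for the square has a factor
    \<open>X k\<close> on both sides: the scalars are exactly what the exchange relations for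
    \<open>X k * X (k - 2)\<close> and \<open>X k * X (k + 2)\<close> consume.\<close>
  show "X k * D = w (-1) *\<^sub>c X (k - 2) + w 1 *\<^sub>c X (k + 2)" if "even k"
  proof (rule X_cancel)
    have ex: "X k * X (k + 2) = w 1 *\<^sub>c X (k + 1) + 1" "X k * X (k - 2) = w (-1) *\<^sub>c X (k - 1) + 1"
      using exchange_odd[of "k + 1"] exchange_odd'[of "k - 1"] that by (simp_all add: add.commute)
    have "X k * (X k * D) = w (-2) *\<^sub>c X (k - 1) + w 2 *\<^sub>c X (k + 1) + (w 1 + w (-1)) *\<^sub>c 1"
      using E[OF that] by (simp add: mult.assoc)
    also have "\<dots> = w (-1) *\<^sub>c (X k * X (k - 2)) + w 1 *\<^sub>c (X k * X (k + 2))"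
      unfolding ex by (simp add: cscale_distrib w_simps)
    finally show "X k * (X k * D) = X k * (w (-1) *\<^sub>c X (k - 2) + w 1 *\<^sub>c X (k + 2))"
      by (simp add: cscale_mult distrib_left)
  qed
qed

end

section \<open>The quantum torus\<close>

text \<open>The exponents \<open>(j, a, b)\<close> of \<open>v^j X^(a,b)\<close>, written additively but with the noncommutative
  composition of \<open>twist\<close>: the convolution product on \<open>heis \<Rightarrow>\<^sub>0 int\<close> is then that of the
  quantum torus.\<close>

datatype heis = Heis (unHeis: "int \<times> int \<times> int")

instantiation heis :: monoid_add
begin

definition zero_heis :: heis where "0 = Heis (0, 0, 0)"
definition plus_heis :: "heis \<Rightarrow> heis \<Rightarrow> heis" where "x + y = Heis (twist (unHeis x) (unHeis y))"

instance
proof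
  fix x y z :: heis
  show "x + y + z = x + (y + z)"
    by (cases x; cases y; cases z) (auto simp: plus_heis_def algebra_simps)
  show "0 + x = x" "x + 0 = x"
    by (cases x; auto simp: plus_heis_def zero_heis_def)+
qed

end

type_synonym torus = "heis \<Rightarrow>\<^sub>0 int"

section \<open>Leading terms in the quantum torus\<close>

lemma poly_mapping_sum_single:
  "p = (\<Sum>k\<in>Poly_Mapping.keys p. Poly_Mapping.single k (Poly_Mapping.lookup p k))"
  by (rule poly_mapping_eqI) (simp add: lookup_sum lookup_single when_def in_keys_iff)

lemma poly_mapping_mult_singles:
  fixes p q :: "'k::monoid_add \<Rightarrow>\<^sub>0 'b::semiring_0"
  shows "p * q = (\<Sum>x\<in>Poly_Mapping.keys p. \<Sum>y\<in>Poly_Mapping.keys q.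
    Poly_Mapping.single (x + y) (Poly_Mapping.lookup p x * Poly_Mapping.lookup q y))"
  by (subst poly_mapping_sum_single[of p], subst poly_mapping_sum_single[of q])
     (simp only: sum_product mult_single)

text \<open>The power of \<open>v\<close> is compared last: \<open>twist\<close> adds a term
  depending on the other two coordinates to it, so it is controlled only after these agree.\<close>

definition heis_ord :: "heis \<Rightarrow> int \<times> int \<times> int" where
  "heis_ord x = (case unHeis x of (j, a, b) \<Rightarrow> (a, b, j))"

text \<open>The sum of two leading exponents arises in only one way. Once the first two coordinates
  are known to agree, the twisting terms on both sides are equal and the powers of \<open>v\<close>
  can be compared.\<close>

lemma heis_ord_add_eq:
  assumes "heis_ord x' \<le> heis_ord x" "heis_ord y' \<le> heis_ord y" "x' + y' = x + y"
  shows "x' = x \<and> y' = y"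
proof -
  obtain j a b where x: "x = Heis (j, a, b)" by (metis heis.exhaust prod_cases3)
  obtain k c d where y: "y = Heis (k, c, d)" by (metis heis.exhaust prod_cases3)
  obtain j' a' b' where x': "x' = Heis (j', a', b')" by (metis heis.exhaust prod_cases3)
  obtain k' c' d' where y': "y' = Heis (k', c', d')" by (metis heis.exhaust prod_cases3)
  have sums: "a' + c' = a + c" "b' + d' = b + d" "j' + k' + a' * d' - b' * c' = j + k + a * d - b * c"
    using assms(3) by (simp_all add: x y x' y' plus_heis_def)
  have le: "a' < a \<or> a' \<le> a \<and> (b' < b \<or> b' \<le> b \<and> j' \<le> j)" "c' < c \<or> c' \<le> c \<and> (d' < d \<or> d' \<le> d \<and> k' \<le> k)"
    using assms(1,2) by (simp_all add: x y x' y' heis_ord_def)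
  have a: "a' = a" "c' = c" using le sums(1) by linarith+
  have b: "b' = b" "d' = d" using le sums(2) a by linarith+
  have "j' = j" "k' = k" using le sums(3) unfolding a b by linarith+
  then show ?thesis using a b by (simp add: x y x' y')
qed

lemma heis_leading_key:
  assumes "(p :: torus) \<noteq> 0"
  obtains x where "x \<in> Poly_Mapping.keys p" "\<And>y. y \<in> Poly_Mapping.keys p \<Longrightarrow> heis_ord y \<le> heis_ord x"
proof -
  let ?M = "heis_ord ` Poly_Mapping.keys p"
  have M: "finite ?M" "?M \<noteq> {}" using assms by simp_all
  obtain x where x: "x \<in> Poly_Mapping.keys p" "Max ?M = heis_ord x"
    using Max_in[OF M] by (rule imageE) simp
  show ?thesis
  proof (rule that[OF x(1)])
    fix y assume "y \<in> Poly_Mapping.keys p"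
    then show "heis_ord y \<le> heis_ord x" using Max_ge[OF M(1), of "heis_ord y"] x(2) by simp
  qed
qed

lemma torus_no_zero_divisors:
  assumes "(p :: torus) * q = 0"
  shows "p = 0 \<or> q = 0"
proof (rule ccontr)
  assume "\<not> (p = 0 \<or> q = 0)"
  then have "p \<noteq> 0" "q \<noteq> 0" by simp_all
  obtain x where x: "x \<in> Poly_Mapping.keys p" "\<And>z. z \<in> Poly_Mapping.keys p \<Longrightarrow> heis_ord z \<le> heis_ord x"
    using heis_leading_key[OF \<open>p \<noteq> 0\<close>] by blast
  obtain y where y: "y \<in> Poly_Mapping.keys q" "\<And>z. z \<in> Poly_Mapping.keys q \<Longrightarrow> heis_ord z \<le> heis_ord y"
    using heis_leading_key[OF \<open>q \<noteq> 0\<close>] by blast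
  have "Poly_Mapping.lookup (p * q) (x + y) = (\<Sum>a\<in>Poly_Mapping.keys p. \<Sum>b\<in>Poly_Mapping.keys q.
      Poly_Mapping.lookup p a * Poly_Mapping.lookup q b when a + b = x + y)"
    by (simp add: poly_mapping_mult_singles[of p q] lookup_sum lookup_single)
  also have "\<dots> = (\<Sum>a\<in>Poly_Mapping.keys p. \<Sum>b\<in>Poly_Mapping.keys q.
      if b = y then (if a = x then Poly_Mapping.lookup p a * Poly_Mapping.lookup q b else 0) else 0)"
  proof (intro sum.cong refl)
    fix a b assume "a \<in> Poly_Mapping.keys p" "b \<in> Poly_Mapping.keys q"
    then have "a + b = x + y \<longleftrightarrow> a = x \<and> b = y"
      using heis_ord_add_eq x(2) y(2) by blast
    then show "(Poly_Mapping.lookup p a * Poly_Mapping.lookup q b when a + b = x + y) =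
      (if b = y then (if a = x then Poly_Mapping.lookup p a * Poly_Mapping.lookup q b else 0) else 0)"
      by (simp add: when_def)
  qed
  also have "\<dots> = Poly_Mapping.lookup p x * Poly_Mapping.lookup q y"
    using x(1) y(1) by (simp add: sum.delta)
  finally show False using assms x(1) y(1) by (simp add: in_keys_iff)
qed

section \<open>Translation from \<open>qt\<close> with \<open>qmult\<close> to the convolution
  ring\<close>

definition to_torus :: "qt \<Rightarrow> torus" where
  "to_torus p = Poly_Mapping.map_key unHeis p"

lemma inj_unHeis: "inj unHeis"
  by (simp add: heis.expand injI)

lemma lookup_to_torus: "Poly_Mapping.lookup (to_torus p) x = Poly_Mapping.lookup p (unHeis x)"
  unfolding to_torus_def using inj_unHeis by (simp add: map_key.rep_eq)

lemma to_torus_inject: "to_torus p = to_torus q \<longleftrightarrow> p = q"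
  by (metis heis.sel lookup_to_torus poly_mapping_eqI)

lemma to_torus_single: "to_torus (Poly_Mapping.single k c) = Poly_Mapping.single (Heis k) c"
  by (rule poly_mapping_eqI) (auto simp: lookup_to_torus lookup_single when_def)

lemma to_torus_add: "to_torus (p + q) = to_torus p + to_torus q"
  and to_torus_diff: "to_torus (p - q) = to_torus p - to_torus q"
  and to_torus_0: "to_torus 0 = 0"
  by (rule poly_mapping_eqI; simp add: lookup_to_torus lookup_add lookup_minus)+

lemma to_torus_sum: "to_torus (sum f A) = (\<Sum>x\<in>A. to_torus (f x))"
  by (induction A rule: infinite_finite_induct) (simp_all add: to_torus_0 to_torus_add)

lemma keys_to_torus: "Poly_Mapping.keys (to_torus p) = Heis ` Poly_Mapping.keys p"
proof (rule set_eqI)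
  fix x
  show "x \<in> Poly_Mapping.keys (to_torus p) \<longleftrightarrow> x \<in> Heis ` Poly_Mapping.keys p"
    by (cases x) (auto simp: in_keys_iff lookup_to_torus image_iff)
qed

lemma to_torus_mult: "to_torus (p \<odot> q) = to_torus p * to_torus q"
proof -
  have inj: "inj_on Heis A" for A by (simp add: inj_on_def)
  show ?thesis
    unfolding qmult_def poly_mapping_mult_singles[of "to_torus p"] keys_to_torus
    by (simp add: sum.reindex[OF inj] to_torus_sum to_torus_single lookup_to_torus plus_heis_def)
qed

lift_definition wt :: "int \<Rightarrow> torus center" is "\<lambda>j. Poly_Mapping.single (Heis (j, 0, 0)) 1"
proof -
  fix j and x :: torus
  have "Heis (j, 0, 0) + k = k + Heis (j, 0, 0)" for k
    by (cases k) (auto simp: plus_heis_def)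
  then show "Poly_Mapping.single (Heis (j, 0, 0)) 1 * x = x * Poly_Mapping.single (Heis (j, 0, 0)) 1"
    by (subst (1 2) poly_mapping_sum_single[of x]) (simp add: sum_distrib_left sum_distrib_right mult_single)
qed

lemma torus_one: "Poly_Mapping.single (Heis (0, 0, 0)) 1 = (1 :: torus)"
  by (simp add: single_one flip: zero_heis_def)

lemma wt_mult: "wt i * wt j = wt (i + j)"
  by transfer (simp add: mult_single plus_heis_def)

lemma wt_0: "wt 0 = 1"
  by transfer (rule torus_one)

lemma wt_neq_1:
  assumes "j \<noteq> 0"
  shows "wt j \<noteq> 1"
proof
  assume "wt j = 1"
  then have "Poly_Mapping.single (Heis (j, 0, 0)) 1 = (Poly_Mapping.single (Heis (0, 0, 0)) 1 :: torus)"
    by transfer (simp add: torus_one)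
  then have "Poly_Mapping.lookup (Poly_Mapping.single (Heis (j, 0, 0)) 1) (Heis (j, 0, 0)) =
      (Poly_Mapping.lookup (Poly_Mapping.single (Heis (0, 0, 0)) 1) (Heis (j, 0, 0)) :: int)"
    by simp
  then show False using assms by (simp add: lookup_single when_def)
qed

lemma to_torus_qh: "to_torus (qh j) = of_center (wt j)"
  by (simp add: qh_def to_torus_single wt.rep_eq)

lemma to_torus_qone: "to_torus qone = 1"
  by (simp add: qone_def to_torus_qh wt_0 one_center.rep_eq)

lemma to_torus_qint: "to_torus (qint c) = of_int c"
  by (simp add: qint_def to_torus_single single_of_int[symmetric] flip: zero_heis_def)

lemma to_torus_qpow: "to_torus (qpow f n) = to_torus f ^ n"
  by (induction n) (simp_all add: to_torus_qone to_torus_mult power_commutes)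

lemma to_torus_F: "to_torus (F n x) = Fcheb (to_torus x) n"
proof -
  have "to_torus (cheb x k) = chebyshev (to_torus x) k" for k
    by (induction x k rule: cheb.induct)
       (simp_all add: to_torus_qone to_torus_mult to_torus_diff to_torus_qint)
  then show ?thesis by (simp add: F_def Fcheb_def to_torus_0)
qed

lemma to_torus_cnk:
  assumes "cluster_relations wt x d"
  shows "to_torus (cnk n k) = of_center (wt (- 4 * n) * cluster_relations.gamma wt k)"
proof -
  interpret cluster_relations wt x d by (rule assms)
  \<comment> \<open>Every exponent in \<open>cnk n k\<close> splits into \<open>- 4 * n\<close> and
    the corresponding exponent in \<open>gamma k\<close>.\<close>
  have e: "2 * (- 2 * (n - i) - 1) = - 4 * n + (4 * i - 2)" "2 * (4 * k - 2 * (n + i) + 1) = - 4 * n + (8 * k - 4 * i + 2)"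
    "2 * (- 2 * (n - i)) = - 4 * n + 4 * i" "2 * (4 * k - 2 * (n + i)) = - 4 * n + (8 * k - 4 * i)" for i
    by simp_all
  have q: "to_torus (qint c \<odot> qh i) = of_center (of_int c * wt i)"
    "to_torus (qint c \<odot> (qh i + qh j)) = of_center (of_int c * (wt i + wt j))" for c i j
    by (simp_all add: to_torus_mult to_torus_add to_torus_qint to_torus_qh of_center_of_int of_center_simps)
  have g: "wt (- 4 * n) * (c * (wt i + wt j)) = c * (wt (- 4 * n + i) + wt (- 4 * n + j))"
    "wt (- 4 * n) * (c * wt i) = c * wt (- 4 * n + i)" for c i j
    by (simp_all only: mult.left_commute[of "wt (- 4 * n)"] distrib_left wt_mult)
  show ?thesis
    unfolding cnk_def gamma_def distrib_left[of "wt (- 4 * n)"] sum_distrib_left g e to_torus_add to_torus_sum q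
    by (simp only: of_center_sum plus_center.rep_eq)
qed

section \<open>The identities in the quantum torus\<close>

theorem theorem3p3:
  fixes X :: "int \<Rightarrow> qt"
  assumes X1: "X 1 = tX 1 0"
    and X2: "X 2 = tX 0 1"
    and rec_odd: "\<And>k. odd k \<Longrightarrow> X (k - 1) \<odot> X (k + 1) = qh 1 \<odot> X k + qone"
    and rec_even: "\<And>k. even k \<Longrightarrow> X (k - 1) \<odot> X (k + 1) = qh 4 \<odot> qpow (X k) 4 + qone"
  shows
   "(\<forall>m n::int. even m \<and> 0 < n \<longrightarrow>
       X m \<odot> F n Xdelta = qh (- n) \<odot> X (m - 2 * n) + qh n \<odot> X (m + 2 * n))
  \<and> (\<forall>m n::int. odd m \<and> 0 < n \<longrightarrow>
       X m \<odot> F n Xdelta =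
         qh (- 2 * n) \<odot> qpow (X (m - n)) (ang (m - n))
       + qh (2 * n) \<odot> qpow (X (m + n)) (ang (m + n))
       + (\<Sum>k\<in>{1..n}. (\<Sum>l\<in>{1..k}. qh (- (4 * l - 1)) + qh (- (4 * l - 3))
                                   + qh (4 * l - 3) + qh (4 * l - 1))
                        \<odot> F (n - 2 * k) Xdelta))
  \<and> (\<forall>m n::int. even m \<and> 0 < n \<longrightarrow>
       X m \<odot> X (m + 2 * n) =
         qh n \<odot> qpow (X (m + n)) (ang (m + n))
       + (\<Sum>k\<in>{1..n}. (\<Sum>l\<in>{1..2 * k - 1}. qh (- (n + 1) + 2 * l))
                        \<odot> F (n - 2 * k + 1) Xdelta))
  \<and> (\<forall>m n::int. even m \<and> 0 < n \<and> odd n \<longrightarrow>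
       X (m - n) \<odot> X m =
         (\<Sum>k\<in>{k. 0 < k \<and> 1 < 2 * k \<and> 2 * k < n}.
             (\<Sum>l\<in>{1..min (4 * k) (n - 2 * k)}. qh (- 1 - 2 * k + 2 * l)) \<odot> X (m - 4 * k))
       + (if n mod 3 = 0 then qh n \<odot> qpow (X (m - (2 * n) div 3)) 3
          else qh (n - 1) \<odot>
                 (X \<lfloor>real_of_int m - 2 * real_of_int n / 3\<rfloor>
                  \<odot> X \<lceil>real_of_int m - 2 * real_of_int n / 3\<rceil>)))
  \<and> (\<forall>m n::int. even m \<and> 0 < n \<and> odd n \<longrightarrow>
       X (m + n) \<odot> X m =
         (\<Sum>k\<in>{k. 0 < k \<and> 1 < 2 * k \<and> 2 * k < n}.
             (\<Sum>l\<in>{1..min (4 * k) (n - 2 * k)}. qh (1 + 2 * k - 2 * l)) \<odot> X (m + 4 * k))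
       + (if n mod 3 = 0 then qh (- n) \<odot> qpow (X (m + (2 * n) div 3)) 3
          else qh (- (n + 1)) \<odot>
                 (X \<lfloor>real_of_int m + 2 * real_of_int n / 3\<rfloor>
                  \<odot> X \<lceil>real_of_int m + 2 * real_of_int n / 3\<rceil>)))
  \<and> (\<forall>m n::int. odd m \<and> 0 < n \<longrightarrow>
       X m \<odot> X (m + 2 * n) =
         qh (4 * n) \<odot> qpow (X (m + n)) (2 * ang (m + n))
       + (\<Sum>k\<in>{1..n - 1}. (\<Sum>l\<in>{1..4 * min k (n - k)}. qh (- 1 + 2 * l))
                            \<odot> X (m + 2 * n - 2 * k))
       + (\<Sum>k\<in>{1..n}. cnk n k \<odot> F (2 * n - 2 * k) Xdelta))"
proof -
  define x where "x k = to_torus (X k)" for k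
  define d where "d = to_torus Xdelta"
  note tt = to_torus_mult to_torus_add to_torus_qh to_torus_qone to_torus_qpow x_def[symmetric]
  have x1: "x 1 = Poly_Mapping.single (Heis (0, 1, 0)) 1" and x2: "x 2 = Poly_Mapping.single (Heis (0, 0, 1)) 1"
    by (simp_all add: x_def X1 X2 tX_def to_torus_single)
  have d: "d = Poly_Mapping.single (Heis (0, -1, -2)) 1 + Poly_Mapping.single (Heis (0, -1, 2)) 1
      + Poly_Mapping.single (Heis (0, 1, -2)) 1
      + (Poly_Mapping.single (Heis (-1, 0, 0)) 1 + Poly_Mapping.single (Heis (1, 0, 0)) 1) * Poly_Mapping.single (Heis (0, 0, -2)) 1"
    by (simp add: d_def Xdelta_def to_torus_mult to_torus_add tX_def qh_def to_torus_single)
  interpret cluster_seed wt x d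
  proof
    show "p * q = 0 \<Longrightarrow> p = 0 \<or> q = 0" for p q :: torus
      by (rule torus_no_zero_divisors)
    show "wt i * wt j = wt (i + j)" "wt 0 = 1" for i j
      by (simp_all add: wt_mult wt_0)
    show "wt j \<noteq> 1" if "j \<noteq> 0" for j using that by (rule wt_neq_1)
    show "x 1 \<noteq> 0" "x 2 \<noteq> 0" unfolding x1 x2 by simp_all
    show "x 1 * x 2 = wt 2 *\<^sub>c (x 2 * x 1)"
      by (simp add: x1 x2 cscale_def wt.rep_eq mult_single plus_heis_def)
    \<comment> \<open>Both sides are explicit Laurent polynomials in the initial cluster; expanding
      them into monomials decides the equation.\<close>
    show "x 1 * (x 2 * x 2 * d) =
        wt (-2) *\<^sub>c (x 1 * x 1) + wt 2 *\<^sub>c (wt 4 *\<^sub>c x 2 ^ 4 + 1) + (wt 1 + wt (-1)) *\<^sub>c x 1"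
      by (simp add: x1 x2 d cscale_def wt.rep_eq plus_center.rep_eq mult_single plus_heis_def
          distrib_left distrib_right numeral_eq_Suc flip: torus_one)
    show "x (k - 1) * x (k + 1) = wt 1 *\<^sub>c x k + 1" if "odd k" for k
      using arg_cong[OF rec_odd[OF that], of to_torus] by (simp only: tt cscale_def)
    show "x (k - 1) * x (k + 1) = wt 4 *\<^sub>c x k ^ 4 + 1" if "even k" for k
      using arg_cong[OF rec_even[OF that], of to_torus] by (simp only: tt cscale_def)
  qed
  note tr = to_torus_inject[symmetric] tt to_torus_F to_torus_sum d_def[symmetric] to_torus_cnk[OF cluster_relations_axioms]
  note cs = cscale_def of_center_sum plus_center.rep_eq
  have p1: "X m \<odot> F n Xdelta = qh (- n) \<odot> X (m - 2 * n) + qh n \<odot> X (m + 2 * n)" if "even m" "0 < n" for m n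
    using even_F[OF that] by (simp only: tr cs)
  have p2: "X m \<odot> F n Xdelta =
         qh (- 2 * n) \<odot> qpow (X (m - n)) (ang (m - n))
       + qh (2 * n) \<odot> qpow (X (m + n)) (ang (m + n))
       + (\<Sum>k\<in>{1..n}. (\<Sum>l\<in>{1..k}. qh (- (4 * l - 1)) + qh (- (4 * l - 3))
                                   + qh (4 * l - 3) + qh (4 * l - 1))
                        \<odot> F (n - 2 * k) Xdelta)" if "odd m" "0 < n" for m n
    using odd_F[OF that] by (simp only: tr cs Y_def s_coef_def)
  have p3: "X m \<odot> X (m + 2 * n) =
         qh n \<odot> qpow (X (m + n)) (ang (m + n))
       + (\<Sum>k\<in>{1..n}. (\<Sum>l\<in>{1..2 * k - 1}. qh (- (n + 1) + 2 * l))
                        \<odot> F (n - 2 * k + 1) Xdelta)" if "even m" "0 < n" for m n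
    using even_even[OF that(1), of n] that(2) by (simp only: tr cs Y_def less_imp_le)
  have p4: "X (m - n) \<odot> X m =
         (\<Sum>k\<in>{k. 0 < k \<and> 1 < 2 * k \<and> 2 * k < n}.
             (\<Sum>l\<in>{1..min (4 * k) (n - 2 * k)}. qh (- 1 - 2 * k + 2 * l)) \<odot> X (m - 4 * k))
       + (if n mod 3 = 0 then qh n \<odot> qpow (X (m - (2 * n) div 3)) 3
          else qh (n - 1) \<odot>
                 (X \<lfloor>real_of_int m - 2 * real_of_int n / 3\<rfloor>
                  \<odot> X \<lceil>real_of_int m - 2 * real_of_int n / 3\<rceil>))" if "even m" "0 < n" "odd n" for m n
    using odd_even[OF that(1,3,2)] by (simp only: tr cs if_distrib[of to_torus])
  have p5: "X (m + n) \<odot> X m =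
         (\<Sum>k\<in>{k. 0 < k \<and> 1 < 2 * k \<and> 2 * k < n}.
             (\<Sum>l\<in>{1..min (4 * k) (n - 2 * k)}. qh (1 + 2 * k - 2 * l)) \<odot> X (m + 4 * k))
       + (if n mod 3 = 0 then qh (- n) \<odot> qpow (X (m + (2 * n) div 3)) 3
          else qh (- (n + 1)) \<odot>
                 (X \<lfloor>real_of_int m + 2 * real_of_int n / 3\<rfloor>
                  \<odot> X \<lceil>real_of_int m + 2 * real_of_int n / 3\<rceil>))" if "even m" "0 < n" "odd n" for m n
    using odd_even_reflected[OF that(1,3,2)] by (simp only: tr cs if_distrib[of to_torus])
  have p6: "X m \<odot> X (m + 2 * n) =
         qh (4 * n) \<odot> qpow (X (m + n)) (2 * ang (m + n))
       + (\<Sum>k\<in>{1..n - 1}. (\<Sum>l\<in>{1..4 * min k (n - k)}. qh (- 1 + 2 * l))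
                            \<odot> X (m + 2 * n - 2 * k))
       + (\<Sum>k\<in>{1..n}. cnk n k \<odot> F (2 * n - 2 * k) Xdelta)" if "odd m" "0 < n" for m n
    using odd_odd[OF that(1), of n] that(2) by (simp only: tr cs Y_def mult_2 power_add less_imp_le)
  show ?thesis
    by (intro conjI allI impI; elim conjE) (rule p1 p2 p3 p4 p5 p6; assumption)+
qed

end
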